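(* Let $g$ be the Kerr-Newman-(anti-)de Sitter metric with real parameters $a,m,q,\Lambda$ (see context). On the axis $\theta=0$ the invariant $I_5=k_\mu k^\mu$, $k_\mu=-\nabla_\mu(C_{\alpha\beta\gamma\delta}C^{\alpha\beta\gamma\delta})$, equals $$\begin{aligned}I_5(\theta=0)=-\frac{3072\left(\Lambda a^2r^2+\Lambda r^4-3a^2+6mr-3q^2-3r^2\right)}{(a^2+r^2)^{15}}\Big(&21a^6m^2r-5a^6mq^2-105a^4m^2r^3+85a^4mq^2r^2-12a^4q^4r\\&+63a^2m^2r^5-95a^2mq^2r^4+32a^2q^4r^3-3r^7m^2+7mq^2r^6-4q^4r^5\Big)^2.\end{aligned}$$
   Context: Kerr-Newman-(anti-)de Sitter metric: in coordinates $(t,r,\theta,\phi)$, signature $(-,+,+,+)$, $$ds^2=-\frac{\Delta_r}{\Xi^2\rho^2}(dt-a\sin^2\theta\,d\phi)^2+\frac{\rho^2}{\Delta_r}dr^2+\frac{\rho^2}{\Delta_\theta}d\theta^2+\frac{\Delta_\theta\sin^2\theta}{\Xi^2\rho^2}\big(a\,dt-(r^2+a^2)d\phi\big)^2,$$ $\Delta_\theta=1+\frac{a^2\Lambda}{3}\cos^2\theta$, $\Xi=1+\frac{a^2\Lambda}{3}\neq0$, $\Delta_r=(1-\frac{\Lambda}{3}r^2)(r^2+a^2)-2mr+q^2$, $\rho^2=r^2+a^2\cos^2\theta$. $C_{\alpha\beta\gamma\delta}$ is the Weyl tensor of $g$. $I_5$ is a rational function of $(r,\cos\theta)$ with denominator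 a power of $\rho^2$; its value on the axis $\theta=0$ is obtained by continuity. *)

theory Defs
  imports "HOL-Analysis.Analysis"
begin

section \<open>Curvature of a metric in a coordinate chart\<close>

text \<open>A metric is given by its matrix of components as a function of the coordinates. Tensor
  components carry their indices as arguments, in the order in which they are written on the tensor.
  All of these notions are local: at a point of an open set on which the metric is smooth and
  nondegenerate they have their usual meaning, elsewhere they are junk values.\<close>

type_synonym 'n metric = "real^'n \<Rightarrow> real^'n^'n"

definition pderiv_coord :: "'n::finite \<Rightarrow> (real^'n \<Rightarrow> real) \<Rightarrow> real^'n \<Rightarrow> real" where
  "pderiv_coord i f x = deriv (\<lambda>s. f (x + s *\<^sub>R axis i 1)) 0"

definition inv_metric :: "'n::finite metric \<Rightarrow> 'n metric" where
  "inv_metric g x = matrix_inv (g x)"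

text \<open>\<open>christoffel g i j k\<close> is $\Gamma^i{}_{jk}$.\<close>

definition christoffel :: "'n::finite metric \<Rightarrow> 'n \<Rightarrow> 'n \<Rightarrow> 'n \<Rightarrow> real^'n \<Rightarrow> real" where
  "christoffel g i j k x = (1/2) * (\<Sum>l\<in>UNIV. inv_metric g x $ i $ l *
     (pderiv_coord j (\<lambda>y. g y $ l $ k) x + pderiv_coord k (\<lambda>y. g y $ l $ j) x
      - pderiv_coord l (\<lambda>y. g y $ j $ k) x))"

text \<open>\<open>riemann_up g a b c d\<close> is $R^a{}_{bcd}$, with the sign convention
  $R^a{}_{bcd} = \partial_c \Gamma^a{}_{db} - \ldots$\<close>

definition riemann_up :: "'n::finite metric \<Rightarrow> 'n \<Rightarrow> 'n \<Rightarrow> 'n \<Rightarrow> 'n \<Rightarrow> real^'n \<Rightarrow> real" where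
  "riemann_up g a b c d x =
     pderiv_coord c (christoffel g a d b) x - pderiv_coord d (christoffel g a c b) x
     + (\<Sum>e\<in>UNIV. christoffel g a c e x * christoffel g e d b x
                 - christoffel g a d e x * christoffel g e c b x)"

definition riemann :: "'n::finite metric \<Rightarrow> 'n \<Rightarrow> 'n \<Rightarrow> 'n \<Rightarrow> 'n \<Rightarrow> real^'n \<Rightarrow> real" where
  "riemann g a b c d x = (\<Sum>e\<in>UNIV. g x $ a $ e * riemann_up g e b c d x)"

definition ricci :: "'n::finite metric \<Rightarrow> 'n \<Rightarrow> 'n \<Rightarrow> real^'n \<Rightarrow> real" where
  "ricci g b d x = (\<Sum>a\<in>UNIV. riemann_up g a b a d x)"

definition scalar_curvature :: "'n::finite metric \<Rightarrow> real^'n \<Rightarrow> real" where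
  "scalar_curvature g x = (\<Sum>b\<in>UNIV. \<Sum>d\<in>UNIV. inv_metric g x $ b $ d * ricci g b d x)"

text \<open>Meaningful in dimension at least 3.\<close>

definition weyl :: "'n::finite metric \<Rightarrow> 'n \<Rightarrow> 'n \<Rightarrow> 'n \<Rightarrow> 'n \<Rightarrow> real^'n \<Rightarrow> real" where
  "weyl g a b c d x =
     riemann g a b c d x
     - 1 / (real CARD('n) - 2) *
         (g x $ a $ c * ricci g b d x - g x $ a $ d * ricci g b c x
          - g x $ b $ c * ricci g a d x + g x $ b $ d * ricci g a c x)
     + scalar_curvature g x / ((real CARD('n) - 1) * (real CARD('n) - 2)) *
         (g x $ a $ c * g x $ b $ d - g x $ a $ d * g x $ b $ c)"

definition weyl_up :: "'n::finite metric \<Rightarrow> 'n \<Rightarrow> 'n \<Rightarrow> 'n \<Rightarrow> 'n \<Rightarrow> real^'n \<Rightarrow> real" where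
  "weyl_up g a b c d x = (\<Sum>a'\<in>UNIV. \<Sum>b'\<in>UNIV. \<Sum>c'\<in>UNIV. \<Sum>d'\<in>UNIV.
     inv_metric g x $ a $ a' * inv_metric g x $ b $ b' *
     inv_metric g x $ c $ c' * inv_metric g x $ d $ d' * weyl g a' b' c' d' x)"

definition weyl_square :: "'n::finite metric \<Rightarrow> real^'n \<Rightarrow> real" where
  "weyl_square g x = (\<Sum>a\<in>UNIV. \<Sum>b\<in>UNIV. \<Sum>c\<in>UNIV. \<Sum>d\<in>UNIV.
     weyl g a b c d x * weyl_up g a b c d x)"

text \<open>On a scalar the covariant derivative is the partial derivative.\<close>

definition k_covector :: "'n::finite metric \<Rightarrow> 'n \<Rightarrow> real^'n \<Rightarrow> real" where
  "k_covector g \<mu> x = - pderiv_coord \<mu> (weyl_square g) x"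

definition I5 :: "'n::finite metric \<Rightarrow> real^'n \<Rightarrow> real" where
  "I5 g x = (\<Sum>\<mu>\<in>UNIV. \<Sum>\<nu>\<in>UNIV.
     inv_metric g x $ \<mu> $ \<nu> * k_covector g \<mu> x * k_covector g \<nu> x)"

section \<open>The Kerr-Newman-(anti-)de Sitter metric\<close>

text \<open>The coordinates $t, r, \theta, \phi$ of \<open>x\<close> are \<open>x $ 1\<close>, \<open>x $ 2\<close>, \<open>x $ 3\<close>, \<open>x $ 4\<close>.\<close>

definition kn_Xi :: "real \<Rightarrow> real \<Rightarrow> real" where
  "kn_Xi a \<Lambda> = 1 + a^2 * \<Lambda> / 3"

definition kn_Delta_theta :: "real \<Rightarrow> real \<Rightarrow> real \<Rightarrow> real" where
  "kn_Delta_theta a \<Lambda> \<theta> = 1 + a^2 * \<Lambda> / 3 * (cos \<theta>)^2"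

definition kn_Delta_r :: "real \<Rightarrow> real \<Rightarrow> real \<Rightarrow> real \<Rightarrow> real \<Rightarrow> real" where
  "kn_Delta_r a m q \<Lambda> r = (1 - \<Lambda> / 3 * r^2) * (r^2 + a^2) - 2 * m * r + q^2"

definition kn_rho2 :: "real \<Rightarrow> real \<Rightarrow> real \<Rightarrow> real" where
  "kn_rho2 a r \<theta> = r^2 + a^2 * (cos \<theta>)^2"

text \<open>Components of the symmetric tensor square of a covector.\<close>

definition covector_square :: "real^'n \<Rightarrow> real^'n^'n" where
  "covector_square w = (\<chi> i j. w $ i * w $ j)"

definition kn_metric :: "real \<Rightarrow> real \<Rightarrow> real \<Rightarrow> real \<Rightarrow> 4 metric" where
  "kn_metric a m q \<Lambda> x =
    (let r = x $ 2; \<theta> = x $ 3;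
         dt = axis 1 1; dr = axis 2 1; d\<theta> = axis 3 1; d\<phi> = axis 4 1;
         \<Xi> = kn_Xi a \<Lambda>; \<rho>2 = kn_rho2 a r \<theta>;
         \<Delta>r = kn_Delta_r a m q \<Lambda> r; \<Delta>\<theta> = kn_Delta_theta a \<Lambda> \<theta>
     in (- (\<Delta>r / (\<Xi>^2 * \<rho>2))) *\<^sub>R covector_square (dt - (a * (sin \<theta>)^2) *\<^sub>R d\<phi>)
        + (\<rho>2 / \<Delta>r) *\<^sub>R covector_square dr
        + (\<rho>2 / \<Delta>\<theta>) *\<^sub>R covector_square d\<theta>
        + (\<Delta>\<theta> * (sin \<theta>)^2 / (\<Xi>^2 * \<rho>2)) *\<^sub>R
            covector_square (a *\<^sub>R dt - (r^2 + a^2) *\<^sub>R d\<phi>))"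

text \<open>The open set on which the above components are defined and nondegenerate (for nonzero
  $\Xi$). The axis $\theta = 0$ lies on its boundary, since $\det g$ vanishes there.\<close>

definition kn_domain :: "real \<Rightarrow> real \<Rightarrow> real \<Rightarrow> real \<Rightarrow> (real^4) set" where
  "kn_domain a m q \<Lambda> = {x. 0 < x $ 3 \<and> x $ 3 < pi \<and> kn_rho2 a (x $ 2) (x $ 3) \<noteq> 0 \<and>
     kn_Delta_r a m q \<Lambda> (x $ 2) \<noteq> 0 \<and> kn_Delta_theta a \<Lambda> (x $ 3) \<noteq> 0}"

lemma finite_kn_horizons: "finite {r. kn_Delta_r a m q \<Lambda> r = 0}"
proof -
  let ?P = "[: a^2 + q^2, - 2 * m, 1 - \<Lambda> * a^2 / 3, 0, - \<Lambda> / 3 :]"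
  have "kn_Delta_r a m q \<Lambda> r = poly ?P r" for r
    by (simp add: kn_Delta_r_def algebra_simps power2_eq_square)
  moreover have "?P \<noteq> 0" by auto
  ultimately show ?thesis using poly_roots_finite[of ?P] by simp
qed

text \<open>Points of the axis are limits of points of the domain, so a limit within the domain is unique
  there.\<close>

lemma axis_islimpt_kn_domain:
  assumes "kn_Xi a \<Lambda> \<noteq> 0" "p $ 3 = 0" "(p $ 2)^2 + a^2 \<noteq> 0"
  shows "p islimpt kn_domain a m q \<Lambda>"
proof -
  define \<gamma> where "\<gamma> s = p + s *\<^sub>R (axis 2 1 + axis 3 1)" for s :: real
  have comps: "\<gamma> s $ 2 = p $ 2 + s" "\<gamma> s $ 3 = s" for s
    using assms(2) by (auto simp: \<gamma>_def axis_def)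
  have lim: "(\<gamma> \<longlongrightarrow> p) (at_right 0)"
    unfolding \<gamma>_def by (auto intro!: tendsto_eq_intros)
  have ne: "\<gamma> s \<noteq> p" if "s > 0" for s
    using comps(2)[of s] assms(2) that by auto
  have rho: "\<forall>\<^sub>F s in at_right 0. kn_rho2 a (p $ 2 + s) s \<noteq> 0"
  proof (rule tendsto_imp_eventually_ne)
    show "((\<lambda>s. kn_rho2 a (p $ 2 + s) s) \<longlongrightarrow> (p $ 2)^2 + a^2) (at_right 0)"
      unfolding kn_rho2_def by (auto intro!: tendsto_eq_intros)
  qed (use assms in auto)
  have theta: "\<forall>\<^sub>F s in at_right 0. kn_Delta_theta a \<Lambda> s \<noteq> 0"
  proof (rule tendsto_imp_eventually_ne)
    show "((\<lambda>s. kn_Delta_theta a \<Lambda> s) \<longlongrightarrow> kn_Xi a \<Lambda>) (at_right 0)"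
      unfolding kn_Delta_theta_def kn_Xi_def by (auto intro!: tendsto_eq_intros)
  qed (use assms in auto)
  have fin: "finite {s. kn_Delta_r a m q \<Lambda> (p $ 2 + s) = 0}"
  proof -
    have "{s. kn_Delta_r a m q \<Lambda> (p $ 2 + s) = 0}
        = (\<lambda>r. r - p $ 2) ` {r. kn_Delta_r a m q \<Lambda> r = 0}" (is "?A = ?B")
    proof (intro set_eqI iffI)
      fix s assume "s \<in> ?A"
      then show "s \<in> ?B" by (intro image_eqI[of _ _ "p $ 2 + s"]) auto
    qed auto
    then show ?thesis using finite_kn_horizons by simp
  qed
  have "\<forall>\<^sub>F s in at_right 0. s \<notin> {s. kn_Delta_r a m q \<Lambda> (p $ 2 + s) = 0}"
    using islimpt_finite[OF fin, of 0] unfolding islimpt_iff_eventually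
    by (auto intro: filter_leD[OF at_le[of "{0<..}" UNIV]])
  moreover have "\<forall>\<^sub>F s in at_right 0. 0 < s \<and> s < pi"
    using eventually_at_right_field pi_gt_zero by blast
  ultimately have "\<forall>\<^sub>F s in at_right 0. \<gamma> s \<in> kn_domain a m q \<Lambda> - {p}"
    using rho theta
  proof eventually_elim
    case (elim s)
    then show ?case using ne[of s] by (auto simp: kn_domain_def comps)
  qed
  note ev = this
  show ?thesis unfolding islimpt_def
  proof (intro allI impI)
    fix T assume "p \<in> T" "open T"
    then have "\<forall>\<^sub>F s in at_right 0. \<gamma> s \<in> T" using lim by (auto dest: topological_tendstoD)
    with ev have "\<forall>\<^sub>F s in at_right 0. \<gamma> s \<in> kn_domain a m q \<Lambda> - {p} \<and> \<gamma> s \<in> T"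
      by eventually_elim auto
    then obtain s where "\<gamma> s \<in> kn_domain a m q \<Lambda> - {p} \<and> \<gamma> s \<in> T"
      using eventually_happens[of _ "at_right (0::real)"] trivial_limit_at_right_real by blast
    then show "\<exists>y\<in>kn_domain a m q \<Lambda>. y \<in> T \<and> y \<noteq> p" by blast
  qed
qed

end

theory Submission
  imports Defs
begin

text \<open>In the non-normalised Carter coframe $(dt - a \sin^2\theta\, d\phi)/\Xi$, $dr$, $d(\cos\theta)$,
  $(a\,dt - (r^2+a^2)\,d\phi)/\Xi$ the metric is diagonal, and its connection coefficients and curvature are
  rational functions of $r$ and $c = \cos\theta$. The Weyl tensor is of type D: it is determined by the two real
  functions $\psi$, $\tau$ with $\psi + i \tau = 2 (m z - q^2) z^2 / \rho^6$, $z = r + i a c$, and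
  $C_{\alpha\beta\gamma\delta} C^{\alpha\beta\gamma\delta} = 12 (\psi^2 - \tau^2) =: W$. Hence
  $I_5 = (\Delta_r W_r^2 + \Delta_\theta \sin^2\theta\, W_c^2)/\rho^2$, which is continuous up to the axis, where the
  second summand vanishes.\<close>

section \<open>Curvature in a moving frame\<close>

text \<open>The target is defined by coordinate sums: twice differentiated components of a
  non-diagonal metric, then a contraction over eight indices. Expanding these directly would produce
  enormous terms. The general part therefore shows, for any frame diagonalising the metric, that the
  coordinate definitions agree with Cartan's calculus; for the concrete metric there remain finitely
  many rational identities in $r$ and $c$. The connection coefficients are explicit candidates that
  are checked rather than derived: metric compatibility and vanishing torsion determine the
  Levi-Civita connection. Throughout the curvature computation \<open>Q\<close>, \<open>P\<close>
  and their derivatives stay opaque numbers; the actual quartics are inserted only once the Weyl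
  tensor has been reduced to two functions.\<close>

definition has_pderiv :: "(real^'n \<Rightarrow> real) \<Rightarrow> real \<Rightarrow> 'n::finite \<Rightarrow> real^'n \<Rightarrow> bool" where
  "has_pderiv f D i x \<longleftrightarrow> ((\<lambda>s. f (x + s *\<^sub>R axis i 1)) has_field_derivative D) (at 0)"

text \<open>\<open>deriv\<close> is a choice operator, so sum and product rules for
  \<open>pderiv_coord\<close> would need differentiability side conditions. The relation
  \<open>has_pderiv\<close> carries existence along with the value; this is the way back.\<close>

lemma pderiv_coord_eqI: "has_pderiv f D i x \<Longrightarrow> pderiv_coord i f x = D"
  by (simp add: has_pderiv_def pderiv_coord_def DERIV_imp_deriv)

lemma has_pderiv_unique: "has_pderiv f D i x \<Longrightarrow> has_pderiv f D' i x \<Longrightarrow> D = D'"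
  using pderiv_coord_eqI by metis

lemma has_pderiv_pderiv_coord: "has_pderiv f D i x \<Longrightarrow> has_pderiv f (pderiv_coord i f x) i x"
  using pderiv_coord_eqI by metis

lemma has_pderiv_add:
  "has_pderiv f D i x \<Longrightarrow> has_pderiv f' D' i x \<Longrightarrow> has_pderiv (\<lambda>x. f x + f' x) (D + D') i x"
  by (simp add: has_pderiv_def DERIV_add)

lemma has_pderiv_mult:
  "has_pderiv f D i x \<Longrightarrow> has_pderiv f' D' i x
    \<Longrightarrow> has_pderiv (\<lambda>x. f x * f' x) (D * f' x + f x * D') i x"
  unfolding has_pderiv_def by (auto intro!: derivative_eq_intros)

lemma has_pderiv_sum:
  "(\<And>k. k \<in> K \<Longrightarrow> has_pderiv (f k) (D k) i x)
    \<Longrightarrow> has_pderiv (\<lambda>x. \<Sum>k\<in>K. f k x) (\<Sum>k\<in>K. D k) i x"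
  unfolding has_pderiv_def by (rule DERIV_sum)

lemma eventually_coord_line:
  fixes x :: "real^'n::finite"
  assumes "open S" "x \<in> S"
  shows "\<forall>\<^sub>F s in nhds (0::real). x + s *\<^sub>R axis i 1 \<in> S"
proof -
  have "((\<lambda>s::real. x + s *\<^sub>R axis i 1) \<longlongrightarrow> x + 0 *\<^sub>R axis i 1) (nhds 0)"
    by (intro tendsto_intros filterlim_ident)
  then show ?thesis using assms by (simp add: topological_tendstoD)
qed

text \<open>The frame identities hold on an open set only. A coordinate line through one of its
  points stays inside for small parameters, which is all that a derivative sees.\<close>

lemma has_pderiv_cong_open:
  assumes "open S" "x \<in> S" "\<And>y. y \<in> S \<Longrightarrow> f y = f' y"
  shows "has_pderiv f D i x \<longleftrightarrow> has_pderiv f' D i x"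
  unfolding has_pderiv_def
  by (rule DERIV_cong_ev) (auto intro: eventually_mono[OF eventually_coord_line[OF assms(1,2)]]
      assms(3))

lemma pderiv_coord_cong_open:
  assumes "open S" "x \<in> S" "\<And>y. y \<in> S \<Longrightarrow> f y = f' y"
  shows "pderiv_coord i f x = pderiv_coord i f' x"
  unfolding pderiv_coord_def
  by (rule deriv_cong_ev)
    (auto intro: eventually_mono[OF eventually_coord_line[OF assms(1,2)]] assms(3))

lemma sum_kronecker:
  fixes f :: "'n::finite \<Rightarrow> real"
  shows "(\<Sum>A\<in>UNIV. (if A = B then 1 else 0) * f A) = f B"
    and "(\<Sum>A\<in>UNIV. (if B = A then 1 else 0) * f A) = f B"
    and "(\<Sum>A\<in>UNIV. f A * (if A = B then 1 else 0)) = f B"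
    and "(\<Sum>A\<in>UNIV. f A * (if B = A then 1 else 0)) = f B"
  by (simp_all add: if_distrib[of "\<lambda>u. u * _"] if_distrib[of "\<lambda>u. _ * u"] cong: if_cong)

text \<open>The frame \<open>F i A\<close> and its dual coframe \<open>E A i\<close> diagonalise $g$, with diagonal entries \<open>h A\<close> that
  need not be constant: no square roots occur, and the signs of the \<open>h A\<close> do not matter.
  \<open>w A B C\<close> is $\omega^A{}_{BC}$ in $\nabla_{e_C} e_B = \omega^A{}_{BC} e_A$. In \<open>dh\<close> and \<open>dw\<close> the first
  index is a frame direction, in \<open>dE\<close> and \<open>ddE\<close> it is a coordinate direction.\<close>

locale moving_frame =
  fixes g :: "'n::finite metric" and S :: "(real^'n) set"
    and h :: "'n \<Rightarrow> real^'n \<Rightarrow> real" and dh :: "'n \<Rightarrow> 'n \<Rightarrow> real^'n \<Rightarrow> real"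
    and E :: "'n \<Rightarrow> 'n \<Rightarrow> real^'n \<Rightarrow> real" and dE :: "'n \<Rightarrow> 'n \<Rightarrow> 'n \<Rightarrow> real^'n \<Rightarrow> real"
    and ddE :: "'n \<Rightarrow> 'n \<Rightarrow> 'n \<Rightarrow> 'n \<Rightarrow> real^'n \<Rightarrow> real"
    and F :: "'n \<Rightarrow> 'n \<Rightarrow> real^'n \<Rightarrow> real"
    and w :: "'n \<Rightarrow> 'n \<Rightarrow> 'n \<Rightarrow> real^'n \<Rightarrow> real"
    and dw :: "'n \<Rightarrow> 'n \<Rightarrow> 'n \<Rightarrow> 'n \<Rightarrow> real^'n \<Rightarrow> real"
  assumes open_S: "open S"
    and metric_eq: "x \<in> S \<Longrightarrow> g x $ i $ j = (\<Sum>A\<in>UNIV. h A x * E A i x * E A j x)"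
    and dual: "x \<in> S \<Longrightarrow> (\<Sum>i\<in>UNIV. E A i x * F i B x) = (if A = B then 1 else 0)"
    and h_nonzero: "x \<in> S \<Longrightarrow> h A x \<noteq> 0"
    and deriv_h: "x \<in> S \<Longrightarrow> has_pderiv (h A) (\<Sum>C\<in>UNIV. E C i x * dh C A x) i x"
    and deriv_E: "x \<in> S \<Longrightarrow> has_pderiv (E A j) (dE i A j x) i x"
    and deriv_dE: "x \<in> S \<Longrightarrow> has_pderiv (dE j A k) (ddE i j A k x) i x"
    and ddE_sym: "x \<in> S \<Longrightarrow> ddE i j A k x = ddE j i A k x"
    and deriv_F: "x \<in> S \<Longrightarrow> \<exists>D. has_pderiv (F j A) D i x"
    and deriv_w: "x \<in> S \<Longrightarrow> has_pderiv (w A B C) (\<Sum>D\<in>UNIV. E D i x * dw D A B C x) i x"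
    and metric_compat: "x \<in> S \<Longrightarrow>
      (if A = B then dh C A x else 0) = h A x * w A B C x + h B x * w B A C x"
    and torsion_free: "x \<in> S \<Longrightarrow> dE i A j x - dE j A i x
      = (\<Sum>C\<in>UNIV. \<Sum>D\<in>UNIV. (w A C D x - w A D C x) * E C i x * E D j x)"
begin

section \<open>Inverse metric and contractions in a frame\<close>

lemma dual':
  assumes "x \<in> S"
  shows "(\<Sum>A\<in>UNIV. F i A x * E A j x) = (if i = j then 1 else 0)"
proof -
  define M where "M = (\<chi> A i. E A i x)"
  define N where "N = (\<chi> i A. F i A x)"
  have "M ** N = mat 1"
    using dual[OF assms] by (simp add: M_def N_def matrix_matrix_mult_def mat_def vec_eq_iff)
  then have "N ** M = mat 1" using matrix_left_right_inverse by blast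
  then have "(N ** M) $ i $ j = (mat 1 :: real^'n^'n) $ i $ j" by simp
  then show ?thesis by (simp add: M_def N_def matrix_matrix_mult_def mat_def)
qed

text \<open>In matrix form $g = E^T h E$ with $F = E^{-1}$, hence $g^{-1} = F h^{-1} F^T$.\<close>

lemma inv_metric_eq:
  assumes "x \<in> S"
  shows "inv_metric g x $ i $ j = (\<Sum>A\<in>UNIV. F i A x * F j A x / h A x)"
proof -
  define G where "G = (\<chi> i j. \<Sum>A\<in>UNIV. F i A x * F j A x / h A x)"
  have "(\<Sum>k\<in>UNIV. g x $ i $ k * G $ k $ j) = (if i = j then 1 else 0)" for i j
  proof -
    have "(\<Sum>k\<in>UNIV. g x $ i $ k * G $ k $ j)
      = (\<Sum>k\<in>UNIV. \<Sum>A\<in>UNIV. \<Sum>B\<in>UNIV. h A x * E A i x * F j B x / h B x * (E A k x * F k B x))"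
      unfolding G_def metric_eq[OF assms] by (simp add: sum_product mult_ac)
    also have "\<dots> = (\<Sum>A\<in>UNIV. \<Sum>k\<in>UNIV. \<Sum>B\<in>UNIV. h A x * E A i x * F j B x / h B x *
        (E A k x * F k B x))"
      by (rule sum.swap)
    also have "\<dots> = (\<Sum>A\<in>UNIV. \<Sum>B\<in>UNIV. \<Sum>k\<in>UNIV. h A x * E A i x * F j B x / h B x *
        (E A k x * F k B x))"
      by (rule sum.cong[OF refl], rule sum.swap)
    also have "\<dots> = (\<Sum>A\<in>UNIV. \<Sum>B\<in>UNIV. h A x * E A i x * F j B x / h B x * (if A = B then 1 else 0))"
      by (simp add: sum_distrib_left[symmetric] dual[OF assms] del: times_divide_eq_left
          times_divide_eq_right times_divide_times_eq)
    also have "\<dots> = (\<Sum>A\<in>UNIV. F j A x * E A i x)"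
      by (simp only: sum_kronecker) (simp add: h_nonzero[OF assms] mult_ac)
    also have "\<dots> = (if i = j then 1 else 0)" using dual'[OF assms, of j i] by auto
    finally show ?thesis .
  qed
  then have gG: "g x ** G = mat 1"
    by (simp add: matrix_matrix_mult_def mat_def vec_eq_iff)
  then have Gg: "G ** g x = mat 1" using matrix_left_right_inverse by blast
  then have "\<exists>B. g x ** B = mat 1 \<and> B ** g x = mat 1" using gG by blast
  \<comment> \<open>\<open>matrix_inv\<close> picks some two-sided inverse; \<open>G\<close> shows
    that one exists, and uniqueness identifies the choice with \<open>G\<close>.\<close>
  then have "matrix_inv (g x) ** g x = mat 1"
    unfolding matrix_inv_def by (rule someI2_ex) simp
  then have "matrix_inv (g x) = G"
    using gG by (metis matrix_mul_assoc matrix_mul_lid matrix_mul_rid)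
  then show ?thesis by (simp add: inv_metric_def G_def)
qed

lemma raise_index:
  assumes "x \<in> S"
  shows "(\<Sum>l\<in>UNIV. inv_metric g x $ i $ l * (\<Sum>A\<in>UNIV. h A x * E A l x * y A)) =
      (\<Sum>A\<in>UNIV. F i A x * y A)"
proof -
  have "(\<Sum>l\<in>UNIV. inv_metric g x $ i $ l * (\<Sum>A\<in>UNIV. h A x * E A l x * y A))
    = (\<Sum>l\<in>UNIV. \<Sum>B\<in>UNIV. \<Sum>A\<in>UNIV. F i B x / h B x * h A x * y A * (E A l x * F l B x))"
    unfolding inv_metric_eq[OF assms] sum_product by (intro sum.cong refl) simp
  also have "\<dots> = (\<Sum>B\<in>UNIV. \<Sum>l\<in>UNIV. \<Sum>A\<in>UNIV. F i B x / h B x * h A x * y A * (E A l x * F l B x))"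
    by (rule sum.swap)
  also have "\<dots> = (\<Sum>B\<in>UNIV. \<Sum>A\<in>UNIV. \<Sum>l\<in>UNIV. F i B x / h B x * h A x * y A * (E A l x * F l B x))"
    by (rule sum.cong[OF refl], rule sum.swap)
  also have "\<dots> = (\<Sum>B\<in>UNIV. \<Sum>A\<in>UNIV. F i B x / h B x * h A x * y A * (if A = B then 1 else 0))"
    by (simp add: sum_distrib_left[symmetric] dual[OF assms] del: times_divide_eq_left
        times_divide_eq_right times_divide_times_eq)
  also have "\<dots> = (\<Sum>A\<in>UNIV. F i A x * y A)"
    by (simp only: sum_kronecker) (simp add: h_nonzero[OF assms])
  finally show ?thesis .
qed

lemma contract_index:
  assumes "x \<in> S"
  shows "(\<Sum>i\<in>UNIV. \<Sum>j\<in>UNIV. inv_metric g x $ i $ j * (\<Sum>A\<in>UNIV. E A i x * t A) *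
      (\<Sum>A\<in>UNIV. E A j x * y A))
    = (\<Sum>A\<in>UNIV. t A * y A / h A x)"
proof -
  have "(\<Sum>j\<in>UNIV. inv_metric g x $ i $ j * (\<Sum>A\<in>UNIV. E A j x * y A)) =
      (\<Sum>A\<in>UNIV. F i A x * (y A / h A x))" for i
    using raise_index[OF assms, of i "\<lambda>A. y A / h A x"] by (simp add: h_nonzero[OF assms])
  moreover have "(\<Sum>j\<in>UNIV. inv_metric g x $ i $ j * T * U j) = T *
      (\<Sum>j\<in>UNIV. inv_metric g x $ i $ j * U j)"
    for i T and U :: "'n \<Rightarrow> real"
    by (simp add: sum_distrib_left mult_ac)
  ultimately have "(\<Sum>i\<in>UNIV. \<Sum>j\<in>UNIV. inv_metric g x $ i $ j * (\<Sum>A\<in>UNIV. E A i x * t A) *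
      (\<Sum>A\<in>UNIV. E A j x * y A))
     = (\<Sum>i\<in>UNIV. (\<Sum>A\<in>UNIV. E A i x * t A) * (\<Sum>A\<in>UNIV. F i A x * (y A / h A x)))"
    by simp
  also have "\<dots> = (\<Sum>i\<in>UNIV. \<Sum>A\<in>UNIV. \<Sum>B\<in>UNIV. t A * (y B / h B x) * (E A i x * F i B x))"
    unfolding sum_product by (intro sum.cong refl) simp
  also have "\<dots> = (\<Sum>A\<in>UNIV. \<Sum>i\<in>UNIV. \<Sum>B\<in>UNIV. t A * (y B / h B x) * (E A i x * F i B x))"
    by (rule sum.swap)
  also have "\<dots> = (\<Sum>A\<in>UNIV. \<Sum>B\<in>UNIV. \<Sum>i\<in>UNIV. t A * (y B / h B x) * (E A i x * F i B x))"
    by (rule sum.cong[OF refl], rule sum.swap)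
  also have "\<dots> = (\<Sum>A\<in>UNIV. \<Sum>B\<in>UNIV. t A * (y B / h B x) * (if A = B then 1 else 0))"
    by (simp add: sum_distrib_left[symmetric] dual[OF assms] del: times_divide_eq_left
        times_divide_eq_right times_divide_times_eq)
  finally show ?thesis by (simp only: sum_kronecker) simp
qed

section \<open>Connection forms and Christoffel symbols\<close>

definition conn :: "'n \<Rightarrow> 'n \<Rightarrow> 'n \<Rightarrow> real^'n \<Rightarrow> real" where
  "conn i A B x = (\<Sum>C\<in>UNIV. w A B C x * E C i x)"

text \<open>The derivative of the coframe that is covariant in the frame index only. The full
  covariant derivative, which also corrects the coordinate index by the Christoffel symbols,
  vanishes; so this quantity is the Christoffel symbol with its upper index turned into a frame
  index.\<close>

definition cov_E :: "'n \<Rightarrow> 'n \<Rightarrow> 'n \<Rightarrow> real^'n \<Rightarrow> real" where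
  "cov_E j A k x = dE j A k x + (\<Sum>B\<in>UNIV. conn j A B x * E B k x)"

text \<open>This is Cartan's first structure equation without torsion.\<close>

lemma cov_E_sym:
  assumes "x \<in> S"
  shows "cov_E j A k x = cov_E k A j x"
proof -
  have "(\<Sum>B\<in>UNIV. conn j A B x * E B k x) = (\<Sum>B\<in>UNIV. \<Sum>C\<in>UNIV. w A B C x * E C j x * E B k x)"
    by (simp add: conn_def sum_distrib_right)
  also have "\<dots> = (\<Sum>C\<in>UNIV. \<Sum>D\<in>UNIV. w A D C x * E C j x * E D k x)"
    by (rule sum.swap)
  finally have 1: "(\<Sum>B\<in>UNIV. conn j A B x * E B k x) =
      (\<Sum>C\<in>UNIV. \<Sum>D\<in>UNIV. w A D C x * E C j x * E D k x)" .
  have 2: "(\<Sum>B\<in>UNIV. conn k A B x * E B j x) = (\<Sum>C\<in>UNIV. \<Sum>D\<in>UNIV. w A C D x * E C j x * E D k x)"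
    by (simp add: conn_def sum_distrib_right sum_distrib_left mult_ac)
  show ?thesis
    using torsion_free[OF assms, of j A k] 1 2
    by (simp add: cov_E_def algebra_simps sum_subtractf)
qed

text \<open>Metric compatibility trades the derivative of the diagonal entries \<open>h\<close> for
  connection terms, and these are exactly what completes \<open>dE\<close> to
  \<open>cov_E\<close>.\<close>

lemma deriv_metric:
  assumes "x \<in> S"
  shows "pderiv_coord j (\<lambda>y. g y $ l $ k) x
    = (\<Sum>A\<in>UNIV. h A x * (E A l x * cov_E j A k x + E A k x * cov_E j A l x))"
proof -
  have 1: "has_pderiv (\<lambda>y. \<Sum>A\<in>UNIV. h A y * E A l y * E A k y)
     (\<Sum>A\<in>UNIV. ((\<Sum>C\<in>UNIV. E C j x * dh C A x) * E A l x + h A x * dE j A l x) * E A k x +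
         (h A x * E A l x) * dE j A k x) j x"
    by (intro has_pderiv_sum has_pderiv_mult deriv_h deriv_E assms)
  have "pderiv_coord j (\<lambda>y. g y $ l $ k) x = pderiv_coord j
      (\<lambda>y. \<Sum>A\<in>UNIV. h A y * E A l y * E A k y) x"
    by (rule pderiv_coord_cong_open[OF open_S assms]) (simp add: metric_eq)
  also have "\<dots> = (\<Sum>A\<in>UNIV. (\<Sum>C\<in>UNIV. E C j x * dh C A x) * E A l x * E A k x)
      + (\<Sum>A\<in>UNIV. h A x * (dE j A l x * E A k x + E A l x * dE j A k x))"
    by (subst pderiv_coord_eqI[OF 1]) (simp add: algebra_simps sum.distrib)
  also have "(\<Sum>A\<in>UNIV. (\<Sum>C\<in>UNIV. E C j x * dh C A x) * E A l x * E A k x)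
    = (\<Sum>A\<in>UNIV. \<Sum>B\<in>UNIV. (h A x * conn j A B x + h B x * conn j B A x) * E A l x * E B k x)"
  proof (rule sum.cong[OF refl])
    fix A
    have "h A x * conn j A B x + h B x * conn j B A x
      = (\<Sum>C\<in>UNIV. E C j x * (h A x * w A B C x + h B x * w B A C x))" for B
      by (simp add: conn_def sum_distrib_left sum.distrib algebra_simps)
    also have "\<dots> B = (\<Sum>C\<in>UNIV. E C j x * dh C A x) * (if A = B then 1 else 0)" for B
      by (simp add: metric_compat[OF assms, symmetric])
    finally have "(\<Sum>B\<in>UNIV. (h A x * conn j A B x + h B x * conn j B A x) * E A l x * E B k x)
      = (\<Sum>B\<in>UNIV. ((\<Sum>C\<in>UNIV. E C j x * dh C A x) * E A l x * E B k x) * (if A = B then 1 else 0))"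
      by (simp add: mult_ac)
    then show "(\<Sum>C\<in>UNIV. E C j x * dh C A x) * E A l x * E A k x
      = (\<Sum>B\<in>UNIV. (h A x * conn j A B x + h B x * conn j B A x) * E A l x * E B k x)"
      by (simp only: sum_kronecker)
  qed
  also have "\<dots> = (\<Sum>A\<in>UNIV. \<Sum>B\<in>UNIV. h A x * E A l x * (conn j A B x * E B k x))
     + (\<Sum>A\<in>UNIV. \<Sum>B\<in>UNIV. h B x * E B k x * (conn j B A x * E A l x))"
    by (simp add: algebra_simps sum.distrib)
  also have "(\<Sum>A\<in>UNIV. \<Sum>B\<in>UNIV. h B x * E B k x * (conn j B A x * E A l x))
     = (\<Sum>B\<in>UNIV. \<Sum>A\<in>UNIV. h B x * E B k x * (conn j B A x * E A l x))"
    by (rule sum.swap)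
  finally show ?thesis
    by (simp add: cov_E_def algebra_simps sum.distrib sum_distrib_left)
qed

text \<open>By the symmetry of \<open>cov_E\<close>, four of the six terms in the Christoffel
  combination cancel and the remaining two coincide.\<close>

lemma christoffel_eq:
  assumes "x \<in> S"
  shows "christoffel g i j k x = (\<Sum>A\<in>UNIV. F i A x * cov_E j A k x)"
proof -
  have "(\<Sum>l\<in>UNIV. inv_metric g x $ i $ l *
     (pderiv_coord j (\<lambda>y. g y $ l $ k) x + pderiv_coord k (\<lambda>y. g y $ l $ j) x
      - pderiv_coord l (\<lambda>y. g y $ j $ k) x))
    = (\<Sum>l\<in>UNIV. inv_metric g x $ i $ l * (\<Sum>A\<in>UNIV. h A x * E A l x * (2 * cov_E j A k x)))"
  proof (intro sum.cong refl arg_cong2[of _ _ _ _ "(*)"])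
    fix l
    show "pderiv_coord j (\<lambda>y. g y $ l $ k) x + pderiv_coord k (\<lambda>y. g y $ l $ j) x
      - pderiv_coord l (\<lambda>y. g y $ j $ k) x = (\<Sum>A\<in>UNIV. h A x * E A l x * (2 * cov_E j A k x))"
      unfolding deriv_metric[OF assms] sum.distrib[symmetric] sum_subtractf[symmetric]
      by (rule sum.cong[OF refl]) (simp add: cov_E_sym[OF assms, of j _ l]
          cov_E_sym[OF assms, of k _ l] cov_E_sym[OF assms, of k _ j] algebra_simps)
  qed
  then show ?thesis
    by (simp add: christoffel_def raise_index[OF assms] mult.left_commute[of _ 2]
        sum_distrib_left[symmetric])
qed

lemma lower_christoffel:
  assumes "x \<in> S"
  shows "(\<Sum>i\<in>UNIV. E A i x * christoffel g i j k x) = cov_E j A k x"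
proof -
  have "(\<Sum>i\<in>UNIV. E A i x * christoffel g i j k x)
    = (\<Sum>i\<in>UNIV. \<Sum>B\<in>UNIV. cov_E j B k x * (E A i x * F i B x))"
    by (simp add: christoffel_eq[OF assms] sum_distrib_left mult_ac)
  also have "\<dots> = (\<Sum>B\<in>UNIV. \<Sum>i\<in>UNIV. cov_E j B k x * (E A i x * F i B x))"
    by (rule sum.swap)
  also have "\<dots> = (\<Sum>B\<in>UNIV. cov_E j B k x * (if A = B then 1 else 0))"
    by (simp add: sum_distrib_left[symmetric] dual[OF assms])
  finally show ?thesis by (simp only: sum_kronecker)
qed

section \<open>Curvature forms and the Riemann tensor\<close>

definition dconn :: "'n \<Rightarrow> 'n \<Rightarrow> 'n \<Rightarrow> 'n \<Rightarrow> real^'n \<Rightarrow> real" where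
  "dconn c d A B x = (\<Sum>D\<in>UNIV. (\<Sum>C\<in>UNIV. E C c x * dw C A B D x) * E D d x
      + w A B D x * dE c D d x)"

lemma deriv_conn: "x \<in> S \<Longrightarrow> has_pderiv (conn d A B) (dconn c d A B x) c x"
  unfolding conn_def[abs_def] dconn_def
  by (intro has_pderiv_sum has_pderiv_mult deriv_w deriv_E)

lemma deriv_cov_E:
  assumes "x \<in> S"
  shows "has_pderiv (cov_E d A b)
    (ddE c d A b x + (\<Sum>B\<in>UNIV. dconn c d A B x * E B b x + conn d A B x * dE c B b x)) c x"
  unfolding cov_E_def[abs_def]
  by (intro has_pderiv_add has_pderiv_sum has_pderiv_mult deriv_conn deriv_dE deriv_E assms)

lemma deriv_christoffel:
  assumes "x \<in> S"
  shows "has_pderiv (christoffel g i j k) (pderiv_coord c (christoffel g i j k) x) c x"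
proof -
  have "\<exists>D. \<forall>A. has_pderiv (F i A) (D A) c x" by (rule choice) (simp add: deriv_F[OF assms])
  then obtain D where "\<And>A. has_pderiv (F i A) (D A) c x" by blast
  then have "has_pderiv (\<lambda>x. \<Sum>A\<in>UNIV. F i A x * cov_E j A k x)
    (\<Sum>A\<in>UNIV. D A * cov_E j A k x + F i A x * (ddE c j A k x +
        (\<Sum>B\<in>UNIV. dconn c j A B x * E B k x + conn j A B x * dE c B k x))) c x"
    by (intro has_pderiv_sum has_pderiv_mult deriv_cov_E assms)
  then have "has_pderiv (christoffel g i j k)
    (\<Sum>A\<in>UNIV. D A * cov_E j A k x + F i A x * (ddE c j A k x +
        (\<Sum>B\<in>UNIV. dconn c j A B x * E B k x + conn j A B x * dE c B k x))) c x"
    by (subst has_pderiv_cong_open[OF open_S assms christoffel_eq])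
  then show ?thesis by (rule has_pderiv_pderiv_coord)
qed

lemma lower_deriv_christoffel:
  assumes "x \<in> S"
  shows "(\<Sum>a\<in>UNIV. E A a x * pderiv_coord c (christoffel g a d b) x)
    = ddE c d A b x + (\<Sum>B\<in>UNIV. dconn c d A B x * E B b x + conn d A B x * dE c B b x)
      - (\<Sum>a\<in>UNIV. dE c A a x * christoffel g a d b x)"
proof -
  have "has_pderiv (\<lambda>x. \<Sum>a\<in>UNIV. E A a x * christoffel g a d b x)
     (\<Sum>a\<in>UNIV. dE c A a x * christoffel g a d b x + E A a x * pderiv_coord c
         (christoffel g a d b) x) c x"
    by (intro has_pderiv_sum has_pderiv_mult deriv_E deriv_christoffel assms)
  then have "has_pderiv (cov_E d A b)
     (\<Sum>a\<in>UNIV. dE c A a x * christoffel g a d b x + E A a x * pderiv_coord c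
         (christoffel g a d b) x) c x"
    by (subst has_pderiv_cong_open[OF open_S assms lower_christoffel[symmetric]])
  from has_pderiv_unique[OF this deriv_cov_E[OF assms]] show ?thesis
    by (simp add: sum.distrib)
qed

definition curv_form :: "'n \<Rightarrow> 'n \<Rightarrow> 'n \<Rightarrow> 'n \<Rightarrow> real^'n \<Rightarrow> real" where
  "curv_form A B c d x = dconn c d A B x - dconn d c A B x
     + (\<Sum>L\<in>UNIV. conn c A L x * conn d L B x - conn d A L x * conn c L B x)"

definition frame_riem :: "'n \<Rightarrow> 'n \<Rightarrow> 'n \<Rightarrow> 'n \<Rightarrow> real^'n \<Rightarrow> real" where
  "frame_riem A B C D x = dw C A B D x - dw D A B C x
     + (\<Sum>L\<in>UNIV. w A B L x * (w L C D x - w L D C x) + w A L C x * w L B D x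
         - w A L D x * w L B C x)"

text \<open>The summand with \<open>dE\<close> is the one subtracted in
  \<open>lower_deriv_christoffel\<close>; the two cancel in the Riemann tensor.\<close>

lemma lower_quad_christoffel:
  assumes "x \<in> S"
  shows "(\<Sum>a\<in>UNIV. E A a x * (\<Sum>e\<in>UNIV. christoffel g a c e x * christoffel g e d b x))
    = (\<Sum>e\<in>UNIV. dE c A e x * christoffel g e d b x) + (\<Sum>B\<in>UNIV. conn c A B x * cov_E d B b x)"
proof -
  have "(\<Sum>a\<in>UNIV. E A a x * (\<Sum>e\<in>UNIV. christoffel g a c e x * christoffel g e d b x))
    = (\<Sum>a\<in>UNIV. \<Sum>e\<in>UNIV. E A a x * christoffel g a c e x * christoffel g e d b x)"
    by (simp add: sum_distrib_left mult_ac)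
  also have "\<dots> = (\<Sum>e\<in>UNIV. \<Sum>a\<in>UNIV. E A a x * christoffel g a c e x * christoffel g e d b x)"
    by (rule sum.swap)
  also have "\<dots> = (\<Sum>e\<in>UNIV. cov_E c A e x * christoffel g e d b x)"
    by (simp add: sum_distrib_right[symmetric] lower_christoffel[OF assms])
  also have "\<dots> = (\<Sum>e\<in>UNIV. dE c A e x * christoffel g e d b x)
      + (\<Sum>e\<in>UNIV. \<Sum>B\<in>UNIV. conn c A B x * (E B e x * christoffel g e d b x))"
    by (simp add: cov_E_def algebra_simps sum.distrib sum_distrib_left sum_distrib_right)
  also have "(\<Sum>e\<in>UNIV. \<Sum>B\<in>UNIV. conn c A B x * (E B e x * christoffel g e d b x))
     = (\<Sum>B\<in>UNIV. \<Sum>e\<in>UNIV. conn c A B x * (E B e x * christoffel g e d b x))"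
    by (rule sum.swap)
  also have "\<dots> = (\<Sum>B\<in>UNIV. conn c A B x * cov_E d B b x)"
    by (simp add: sum_distrib_left[symmetric] lower_christoffel[OF assms])
  finally show ?thesis .
qed

text \<open>The Christoffel symbols are the gauge transform of the connection forms by the coframe, so their
  curvature is that of the connection forms; the second derivatives of the coframe cancel.\<close>

lemma lower_riemann_up:
  assumes "x \<in> S"
  shows "(\<Sum>a\<in>UNIV. E A a x * riemann_up g a b c d x) = (\<Sum>B\<in>UNIV. curv_form A B c d x * E B b x)"
proof -
  have swap: "(\<Sum>B\<in>UNIV. conn c A B x * (\<Sum>L\<in>UNIV. conn d B L x * E L b x))
    = (\<Sum>B\<in>UNIV. (\<Sum>L\<in>UNIV. conn c A L x * conn d L B x) * E B b x)" for c d
  proof -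
    have "(\<Sum>B\<in>UNIV. conn c A B x * (\<Sum>L\<in>UNIV. conn d B L x * E L b x))
      = (\<Sum>B\<in>UNIV. \<Sum>L\<in>UNIV. conn c A B x * conn d B L x * E L b x)"
      by (simp add: sum_distrib_left mult_ac)
    also have "\<dots> = (\<Sum>L\<in>UNIV. \<Sum>B\<in>UNIV. conn c A B x * conn d B L x * E L b x)"
      by (rule sum.swap)
    finally show ?thesis by (simp add: sum_distrib_right)
  qed
  have "(\<Sum>a\<in>UNIV. E A a x * riemann_up g a b c d x)
    = (\<Sum>a\<in>UNIV. E A a x * pderiv_coord c (christoffel g a d b) x)
     - (\<Sum>a\<in>UNIV. E A a x * pderiv_coord d (christoffel g a c b) x)
     + (\<Sum>a\<in>UNIV. E A a x * (\<Sum>e\<in>UNIV. christoffel g a c e x * christoffel g e d b x))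
     - (\<Sum>a\<in>UNIV. E A a x * (\<Sum>e\<in>UNIV. christoffel g a d e x * christoffel g e c b x))"
    by (simp add: riemann_up_def algebra_simps sum.distrib sum_subtractf)
  also have "\<dots> = (\<Sum>B\<in>UNIV. dconn c d A B x * E B b x) - (\<Sum>B\<in>UNIV. dconn d c A B x * E B b x)
     + (\<Sum>B\<in>UNIV. conn c A B x * (\<Sum>L\<in>UNIV. conn d B L x * E L b x))
     - (\<Sum>B\<in>UNIV. conn d A B x * (\<Sum>L\<in>UNIV. conn c B L x * E L b x))"
    unfolding lower_deriv_christoffel[OF assms] lower_quad_christoffel[OF assms] cov_E_def
        ddE_sym[OF assms, of d c]
    by (simp add: distrib_left sum.distrib)
  also have "\<dots> = (\<Sum>B\<in>UNIV. curv_form A B c d x * E B b x)"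
    unfolding swap by (simp add: curv_form_def algebra_simps sum.distrib sum_subtractf)
  finally show ?thesis .
qed

lemma curv_form_eq:
  assumes "x \<in> S"
  shows "curv_form A B c d x = (\<Sum>C\<in>UNIV. \<Sum>D\<in>UNIV. frame_riem A B C D x * E C c x * E D d x)"
proof -
  have 1: "(\<Sum>D\<in>UNIV. (\<Sum>C\<in>UNIV. E C c x * dw C A B D x) * E D d x)
    = (\<Sum>C\<in>UNIV. \<Sum>D\<in>UNIV. dw C A B D x * E C c x * E D d x)" for c d
  proof -
    have "(\<Sum>D\<in>UNIV. (\<Sum>C\<in>UNIV. E C c x * dw C A B D x) * E D d x)
      = (\<Sum>D\<in>UNIV. \<Sum>C\<in>UNIV. dw C A B D x * E C c x * E D d x)"
      by (simp add: sum_distrib_left sum_distrib_right mult_ac)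
    also have "\<dots> = (\<Sum>C\<in>UNIV. \<Sum>D\<in>UNIV. dw C A B D x * E C c x * E D d x)"
      by (rule sum.swap)
    finally show ?thesis .
  qed
  have swapped: "(\<Sum>D\<in>UNIV. (\<Sum>C\<in>UNIV. E C d x * dw C A B D x) * E D c x)
    = (\<Sum>C\<in>UNIV. \<Sum>D\<in>UNIV. dw D A B C x * E C c x * E D d x)"
    by (simp add: sum_distrib_left sum_distrib_right mult_ac)
  have "(\<Sum>L\<in>UNIV. w A B L x * dE c L d x) - (\<Sum>L\<in>UNIV. w A B L x * dE d L c x)
    = (\<Sum>L\<in>UNIV. w A B L x * (dE c L d x - dE d L c x))"
    by (simp add: algebra_simps sum_subtractf)
  also have "\<dots> = (\<Sum>L\<in>UNIV. \<Sum>C\<in>UNIV. \<Sum>D\<in>UNIV. w A B L x *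
      (w L C D x - w L D C x) * E C c x * E D d x)"
    by (simp add: torsion_free[OF assms] sum_distrib_left mult_ac)
  also have "\<dots> = (\<Sum>C\<in>UNIV. \<Sum>L\<in>UNIV. \<Sum>D\<in>UNIV. w A B L x *
      (w L C D x - w L D C x) * E C c x * E D d x)"
    by (rule sum.swap)
  also have "\<dots> = (\<Sum>C\<in>UNIV. \<Sum>D\<in>UNIV. \<Sum>L\<in>UNIV. w A B L x *
      (w L C D x - w L D C x) * E C c x * E D d x)"
    by (rule sum.cong[OF refl], rule sum.swap)
  finally have 2: "(\<Sum>L\<in>UNIV. w A B L x * dE c L d x) - (\<Sum>L\<in>UNIV. w A B L x * dE d L c x)
    = (\<Sum>C\<in>UNIV. \<Sum>D\<in>UNIV. \<Sum>L\<in>UNIV. w A B L x * (w L C D x - w L D C x) * E C c x * E D d x)" .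
  have 3: "(\<Sum>L\<in>UNIV. conn c A L x * conn d L B x)
    = (\<Sum>C\<in>UNIV. \<Sum>D\<in>UNIV. \<Sum>L\<in>UNIV. w A L C x * w L B D x * E C c x * E D d x)"
  proof -
    have "(\<Sum>L\<in>UNIV. conn c A L x * conn d L B x)
      = (\<Sum>L\<in>UNIV. \<Sum>C\<in>UNIV. \<Sum>D\<in>UNIV. w A L C x * w L B D x * E C c x * E D d x)"
      by (simp add: conn_def sum_product mult_ac)
    also have "\<dots> = (\<Sum>C\<in>UNIV. \<Sum>L\<in>UNIV. \<Sum>D\<in>UNIV. w A L C x * w L B D x * E C c x * E D d x)"
      by (rule sum.swap)
    also have "\<dots> = (\<Sum>C\<in>UNIV. \<Sum>D\<in>UNIV. \<Sum>L\<in>UNIV. w A L C x * w L B D x * E C c x * E D d x)"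
      by (rule sum.cong[OF refl], rule sum.swap)
    finally show ?thesis .
  qed
  have 4: "(\<Sum>L\<in>UNIV. conn d A L x * conn c L B x)
    = (\<Sum>C\<in>UNIV. \<Sum>D\<in>UNIV. \<Sum>L\<in>UNIV. w A L D x * w L B C x * E C c x * E D d x)"
  proof -
    have "(\<Sum>L\<in>UNIV. conn d A L x * conn c L B x)
      = (\<Sum>L\<in>UNIV. \<Sum>C\<in>UNIV. \<Sum>D\<in>UNIV. w A L D x * w L B C x * E C c x * E D d x)"
      by (simp add: conn_def sum_product mult_ac)
    also have "\<dots> = (\<Sum>C\<in>UNIV. \<Sum>L\<in>UNIV. \<Sum>D\<in>UNIV. w A L D x * w L B C x * E C c x * E D d x)"
      by (rule sum.swap)
    also have "\<dots> = (\<Sum>C\<in>UNIV. \<Sum>D\<in>UNIV. \<Sum>L\<in>UNIV. w A L D x * w L B C x * E C c x * E D d x)"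
      by (rule sum.cong[OF refl], rule sum.swap)
    finally show ?thesis .
  qed
  have "curv_form A B c d x
    = (\<Sum>C\<in>UNIV. \<Sum>D\<in>UNIV. dw C A B D x * E C c x * E D d x)
    - (\<Sum>C\<in>UNIV. \<Sum>D\<in>UNIV. dw D A B C x * E C c x * E D d x)
    + ((\<Sum>L\<in>UNIV. w A B L x * dE c L d x) - (\<Sum>L\<in>UNIV. w A B L x * dE d L c x))
    + (\<Sum>L\<in>UNIV. conn c A L x * conn d L B x) - (\<Sum>L\<in>UNIV. conn d A L x * conn c L B x)"
    by (simp only: curv_form_def dconn_def sum.distrib sum_subtractf 1[of c d] swapped)
  also have "\<dots> = (\<Sum>C\<in>UNIV. \<Sum>D\<in>UNIV. dw C A B D x * E C c x * E D d x
      - dw D A B C x * E C c x * E D d x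
     + (\<Sum>L\<in>UNIV. w A B L x * (w L C D x - w L D C x) * E C c x * E D d x)
     + (\<Sum>L\<in>UNIV. w A L C x * w L B D x * E C c x * E D d x)
     - (\<Sum>L\<in>UNIV. w A L D x * w L B C x * E C c x * E D d x))"
    by (simp only: 2 3 4 sum.distrib sum_subtractf)
  also have "\<dots> = (\<Sum>C\<in>UNIV. \<Sum>D\<in>UNIV. frame_riem A B C D x * E C c x * E D d x)"
    unfolding sum_distrib_right[symmetric]
    by (rule sum.cong[OF refl], rule sum.cong[OF refl])
      (simp add: frame_riem_def sum.distrib sum_subtractf distrib_right left_diff_distrib)
  finally show ?thesis .
qed

lemma riemann_up_eq:
  assumes "x \<in> S"
  shows "riemann_up g a b c d x = (\<Sum>A\<in>UNIV. F a A x * (\<Sum>B\<in>UNIV. curv_form A B c d x * E B b x))"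
proof -
  have "(\<Sum>A\<in>UNIV. F a A x * (\<Sum>B\<in>UNIV. curv_form A B c d x * E B b x))
    = (\<Sum>A\<in>UNIV. \<Sum>e\<in>UNIV. F a A x * E A e x * riemann_up g e b c d x)"
    unfolding lower_riemann_up[OF assms, symmetric] by (simp add: sum_distrib_left mult_ac)
  also have "\<dots> = (\<Sum>e\<in>UNIV. \<Sum>A\<in>UNIV. F a A x * E A e x * riemann_up g e b c d x)"
    by (rule sum.swap)
  also have "\<dots> = (\<Sum>e\<in>UNIV. (if a = e then 1 else 0) * riemann_up g e b c d x)"
    by (simp only: sum_distrib_right[symmetric] dual'[OF assms])
  finally show ?thesis by (simp only: sum_kronecker)
qed

section \<open>Frame components of the Weyl tensor\<close>

definition tensor2 :: "('n \<Rightarrow> 'n \<Rightarrow> real) \<Rightarrow> 'n \<Rightarrow> 'n \<Rightarrow> real^'n \<Rightarrow> real" where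
  "tensor2 T a b x = (\<Sum>A\<in>UNIV. \<Sum>B\<in>UNIV. T A B * E A a x * E B b x)"

definition tensor4 :: "('n \<Rightarrow> 'n \<Rightarrow> 'n \<Rightarrow> 'n \<Rightarrow> real) \<Rightarrow> 'n \<Rightarrow> 'n \<Rightarrow> 'n \<Rightarrow> 'n \<Rightarrow> real^'n \<Rightarrow> real" where
  "tensor4 T a b c d x
    = (\<Sum>A\<in>UNIV. \<Sum>B\<in>UNIV. \<Sum>C\<in>UNIV. \<Sum>D\<in>UNIV. T A B C D * E A a x * E B b x * E C c x * E D d x)"

lemma tensor4_linear:
  "tensor4 (\<lambda>A B C D. T A B C D + U A B C D) a b c d x = tensor4 T a b c d x + tensor4 U a b c d x"
  "tensor4 (\<lambda>A B C D. T A B C D - U A B C D) a b c d x = tensor4 T a b c d x - tensor4 U a b c d x"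
  "tensor4 (\<lambda>A B C D. k * T A B C D) a b c d x = k * tensor4 T a b c d x"
  by (simp_all add: tensor4_def sum.distrib sum_subtractf distrib_right left_diff_distrib
      sum_distrib_left mult.assoc)

lemma tensor2_mult:
  "tensor2 T a c x * tensor2 U b d x = tensor4 (\<lambda>A B C D. T A C * U B D) a b c d x"
  by (simp add: tensor2_def tensor4_def sum_product mult_ac)

lemma tensor2_mult':
  "tensor2 T a d x * tensor2 U b c x = tensor4 (\<lambda>A B C D. T A D * U B C) a b c d x"
proof -
  have "tensor2 T a d x * tensor2 U b c x
    = (\<Sum>A\<in>UNIV. \<Sum>B\<in>UNIV. \<Sum>D\<in>UNIV. \<Sum>C\<in>UNIV. T A D * U B C * E A a x * E B b x * E C c x * E D d x)"
    by (simp add: tensor2_def sum_product mult_ac)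
  also have "\<dots> = (\<Sum>A\<in>UNIV. \<Sum>B\<in>UNIV. \<Sum>C\<in>UNIV. \<Sum>D\<in>UNIV. T A D * U B C * E A a x * E B b x * E C c x *
      E D d x)"
    by (rule sum.cong[OF refl], rule sum.cong[OF refl], rule sum.swap)
  finally show ?thesis by (simp add: tensor4_def)
qed

definition frame_metric :: "real^'n \<Rightarrow> 'n \<Rightarrow> 'n \<Rightarrow> real" where
  "frame_metric x A B = (if A = B then h A x else 0)"

definition frame_ricci :: "real^'n \<Rightarrow> 'n \<Rightarrow> 'n \<Rightarrow> real" where
  "frame_ricci x B D = (\<Sum>A\<in>UNIV. frame_riem A B A D x)"

definition frame_scalar :: "real^'n \<Rightarrow> real" where
  "frame_scalar x = (\<Sum>A\<in>UNIV. frame_ricci x A A / h A x)"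

text \<open>The factor \<open>h A x\<close> lowers the first index. In the last two Ricci products
  the factor with index \<open>A\<close> comes first, matching the shapes produced by
  \<open>tensor2_mult'\<close> and \<open>tensor2_mult\<close>.\<close>

definition frame_weyl :: "real^'n \<Rightarrow> 'n \<Rightarrow> 'n \<Rightarrow> 'n \<Rightarrow> 'n \<Rightarrow> real" where
  "frame_weyl x A B C D = h A x * frame_riem A B C D x
     - 1 / (real CARD('n) - 2) *
         (frame_metric x A C * frame_ricci x B D - frame_metric x A D * frame_ricci x B C
          - frame_ricci x A D * frame_metric x B C + frame_ricci x A C * frame_metric x B D)
     + frame_scalar x / ((real CARD('n) - 1) * (real CARD('n) - 2)) *
         (frame_metric x A C * frame_metric x B D - frame_metric x A D * frame_metric x B C)"

lemma metric_tensor: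
  assumes "x \<in> S"
  shows "g x $ a $ b = tensor2 (frame_metric x) a b x"
proof -
  have "(\<Sum>B\<in>UNIV. frame_metric x A B * E A a x * E B b x)
     = (\<Sum>B\<in>UNIV. (h A x * E A a x * E B b x) * (if A = B then 1 else 0))" for A
    by (intro sum.cong refl) (simp add: frame_metric_def)
  then show ?thesis
    by (simp only: tensor2_def sum_kronecker metric_eq[OF assms])
qed

lemma riemann_tensor:
  assumes "x \<in> S"
  shows "riemann g a b c d x = tensor4 (\<lambda>A B C D. h A x * frame_riem A B C D x) a b c d x"
proof -
  have "riemann g a b c d x
    = (\<Sum>e\<in>UNIV. \<Sum>A\<in>UNIV. h A x * E A a x * (E A e x * riemann_up g e b c d x))"
    by (simp add: riemann_def metric_eq[OF assms] sum_distrib_left sum_distrib_right mult_ac)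
  also have "\<dots> = (\<Sum>A\<in>UNIV. \<Sum>e\<in>UNIV. h A x * E A a x * (E A e x * riemann_up g e b c d x))"
    by (rule sum.swap)
  also have "\<dots> = (\<Sum>A\<in>UNIV. h A x * E A a x * (\<Sum>B\<in>UNIV. curv_form A B c d x * E B b x))"
    by (simp add: sum_distrib_left[symmetric] lower_riemann_up[OF assms])
  finally show ?thesis
    by (simp add: tensor4_def curv_form_eq[OF assms] sum_distrib_left sum_distrib_right mult_ac)
qed

lemma ricci_tensor:
  assumes "x \<in> S"
  shows "ricci g b d x = tensor2 (frame_ricci x) b d x"
proof -
  have "ricci g b d x = (\<Sum>a\<in>UNIV. \<Sum>A\<in>UNIV. \<Sum>B\<in>UNIV. \<Sum>C\<in>UNIV. \<Sum>D\<in>UNIV.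
      frame_riem A B C D x * E B b x * E D d x * (E C a x * F a A x))"
    by (simp add: ricci_def riemann_up_eq[OF assms] curv_form_eq[OF assms] sum_distrib_left
        sum_distrib_right mult_ac)
  also have "\<dots> = (\<Sum>B\<in>UNIV. \<Sum>D\<in>UNIV. \<Sum>A\<in>UNIV. \<Sum>C\<in>UNIV. \<Sum>a\<in>UNIV.
      frame_riem A B C D x * E B b x * E D d x * (E C a x * F a A x))"
    unfolding sum.cartesian_product
    by (rule sum.reindex_bij_witness[of _ "\<lambda>(B, D, A, C, a). (a, A, B, C, D)"
          "\<lambda>(a, A, B, C, D). (B, D, A, C, a)"]) auto
  also have "\<dots> = (\<Sum>B\<in>UNIV. \<Sum>D\<in>UNIV. \<Sum>A\<in>UNIV. frame_riem A B A D x * E B b x * E D d x)"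
    by (simp only: sum_distrib_left[symmetric] dual[OF assms] sum_kronecker)
  finally show ?thesis
    by (simp add: tensor2_def frame_ricci_def sum_distrib_right)
qed

lemma scalar_curvature_eq:
  assumes "x \<in> S"
  shows "scalar_curvature g x = frame_scalar x"
proof -
  have "scalar_curvature g x = (\<Sum>b\<in>UNIV. \<Sum>d\<in>UNIV. inv_metric g x $ b $ d *
      (\<Sum>A\<in>UNIV. \<Sum>B\<in>UNIV. E A b x * (E B d x * frame_ricci x A B)))"
    by (simp add: scalar_curvature_def ricci_tensor[OF assms] tensor2_def mult_ac)
  also have "\<dots> = (\<Sum>b\<in>UNIV. \<Sum>d\<in>UNIV. \<Sum>A\<in>UNIV. \<Sum>B\<in>UNIV.
      inv_metric g x $ b $ d * (E A b x * (E B d x * frame_ricci x A B)))"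
    by (simp add: sum_distrib_left)
  also have "\<dots> = (\<Sum>A\<in>UNIV. \<Sum>b\<in>UNIV. \<Sum>d\<in>UNIV. \<Sum>B\<in>UNIV.
      inv_metric g x $ b $ d * (E A b x * (E B d x * frame_ricci x A B)))"
    unfolding sum.cartesian_product
    by (rule sum.reindex_bij_witness[of _ "\<lambda>(A, b, d, B). (b, d, A, B)" "\<lambda>(b, d, A, B).
        (A, b, d, B)"]) auto
  \<comment> \<open>The lone factor \<open>E A b x\<close> becomes a sum against a Kronecker delta,
    which gives both factors the shape that \<open>contract_index\<close> expects.\<close>
  also have "\<dots> = (\<Sum>A\<in>UNIV. \<Sum>b\<in>UNIV. \<Sum>d\<in>UNIV. inv_metric g x $ b $ d *
      (\<Sum>C\<in>UNIV. E C b x * (if C = A then 1 else 0)) * (\<Sum>B\<in>UNIV. E B d x * frame_ricci x A B))"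
    by (simp only: sum_kronecker) (simp add: sum_distrib_left mult_ac)
  also have "\<dots> = (\<Sum>A\<in>UNIV. \<Sum>B\<in>UNIV. (if B = A then 1 else 0) * (frame_ricci x A B / h B x))"
    by (simp only: contract_index[OF assms] times_divide_eq_right)
  finally show ?thesis
    by (simp only: sum_kronecker frame_scalar_def)
qed

lemma weyl_tensor:
  assumes "x \<in> S"
  shows "weyl g a b c d x = tensor4 (frame_weyl x) a b c d x"
  unfolding frame_weyl_def tensor4_linear tensor2_mult[symmetric] tensor2_mult'[symmetric]
  by (simp add: weyl_def riemann_tensor[OF assms] metric_tensor[OF assms] ricci_tensor[OF assms]
      scalar_curvature_eq[OF assms] mult_ac)

section \<open>The square of the Weyl tensor\<close>

definition contraction :: "real^'n \<Rightarrow> ('n \<Rightarrow> 'n \<Rightarrow> real) \<Rightarrow> real" where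
  "contraction x Z = (\<Sum>i\<in>UNIV. \<Sum>j\<in>UNIV. inv_metric g x $ i $ j * Z i j)"

lemma contraction_sum:
  "contraction x (\<lambda>i j. \<Sum>A\<in>UNIV. k A * Z A i j) = (\<Sum>A\<in>UNIV. k A * contraction x (Z A))"
proof -
  have "contraction x (\<lambda>i j. \<Sum>A\<in>UNIV. k A * Z A i j)
    = (\<Sum>i\<in>UNIV. \<Sum>j\<in>UNIV. \<Sum>A\<in>UNIV. k A * (inv_metric g x $ i $ j * Z A i j))"
    by (simp add: contraction_def sum_distrib_left mult_ac)
  also have "\<dots> = (\<Sum>A\<in>UNIV. \<Sum>i\<in>UNIV. \<Sum>j\<in>UNIV. k A * (inv_metric g x $ i $ j * Z A i j))"
    unfolding sum.cartesian_product
    by (rule sum.reindex_bij_witness[of _ "\<lambda>(A, i, j). (i, j, A)" "\<lambda>(i, j, A). (A, i, j)"]) auto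
  finally show ?thesis by (simp add: contraction_def sum_distrib_left)
qed

lemma contraction_frame:
  assumes "x \<in> S"
  shows "contraction x (\<lambda>i j. (\<Sum>A\<in>UNIV. E A i x * t A) * (\<Sum>A\<in>UNIV. E A j x * y A))
    = (\<Sum>A\<in>UNIV. inverse (h A x) * (t A * y A))"
  using contract_index[OF assms, of t y] by (simp add: contraction_def mult.assoc divide_inverse
      mult_ac)

lemma tensor4_nested:
  "tensor4 T a b c d x
    = (\<Sum>D\<in>UNIV. E D d x * (\<Sum>C\<in>UNIV. E C c x * (\<Sum>B\<in>UNIV. E B b x * (\<Sum>A\<in>UNIV. E A a x * T A B C D))))"
proof -
  have "tensor4 T a b c d x
    = (\<Sum>D\<in>UNIV. \<Sum>C\<in>UNIV. \<Sum>B\<in>UNIV. \<Sum>A\<in>UNIV. T A B C D * E A a x * E B b x * E C c x * E D d x)"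
    unfolding tensor4_def sum.cartesian_product
    by (rule sum.reindex_bij_witness[of _ "\<lambda>(D, C, B, A). (A, B, C, D)" "\<lambda>(A, B, C, D).
        (D, C, B, A)"]) auto
  then show ?thesis by (simp add: sum_distrib_left mult_ac)
qed

text \<open>Grouping each index with its raised partner gives four nested contractions. They can
  then be diagonalised one at a time, from the inside out, which collapses eight sums to
  four.\<close>

lemma weyl_square_contraction:
  "weyl_square g x = contraction x (\<lambda>a a'. contraction x (\<lambda>b b'. contraction x (\<lambda>c c'.
     contraction x (\<lambda>d d'. weyl g a b c d x * weyl g a' b' c' d' x))))"
proof -
  let ?G = "\<lambda>i j. inv_metric g x $ i $ j"
  let ?f = "\<lambda>a b c d a' b' c' d'. ?G a a' * ?G b b' * ?G c c' * ?G d d' * weyl g a b c d x * weyl g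
      a' b' c' d' x"
  have "weyl_square g x = (\<Sum>a\<in>UNIV. \<Sum>b\<in>UNIV. \<Sum>c\<in>UNIV. \<Sum>d\<in>UNIV. \<Sum>a'\<in>UNIV. \<Sum>b'\<in>UNIV. \<Sum>c'\<in>UNIV.
      \<Sum>d'\<in>UNIV.
      ?f a b c d a' b' c' d')"
    by (simp add: weyl_square_def weyl_up_def sum_distrib_left mult_ac)
  also have "\<dots> = (\<Sum>a\<in>UNIV. \<Sum>a'\<in>UNIV. \<Sum>b\<in>UNIV. \<Sum>b'\<in>UNIV. \<Sum>c\<in>UNIV. \<Sum>c'\<in>UNIV. \<Sum>d\<in>UNIV. \<Sum>d'\<in>UNIV.
      ?f a b c d a' b' c' d')"
    unfolding sum.cartesian_product
    by (rule sum.reindex_bij_witness[of _ "\<lambda>(a, a', b, b', c, c', d, d').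
        (a, b, c, d, a', b', c', d')"
          "\<lambda>(a, b, c, d, a', b', c', d'). (a, a', b, b', c, c', d, d')"]) auto
  finally show ?thesis by (simp add: contraction_def sum_distrib_left mult_ac)
qed

lemma weyl_square_eq:
  assumes "x \<in> S"
  shows "weyl_square g x = (\<Sum>D\<in>UNIV. \<Sum>C\<in>UNIV. \<Sum>B\<in>UNIV. \<Sum>A\<in>UNIV.
    (frame_weyl x A B C D)\<^sup>2 / (h A x * h B x * h C x * h D x))"
proof -
  have "weyl_square g x = (\<Sum>D\<in>UNIV. inverse (h D x) * (\<Sum>C\<in>UNIV. inverse (h C x) *
      (\<Sum>B\<in>UNIV. inverse (h B x) * (\<Sum>A\<in>UNIV. inverse (h A x) *
          (frame_weyl x A B C D * frame_weyl x A B C D)))))"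
    unfolding weyl_square_contraction weyl_tensor[OF assms] tensor4_nested
    by (simp only: contraction_frame[OF assms] contraction_sum)
  then show ?thesis
    by (simp add: sum_distrib_left divide_inverse power2_eq_square mult_ac)
qed

end

section \<open>The Carter frame at a point\<close>

definition comp4 :: "'a \<Rightarrow> 'a \<Rightarrow> 'a \<Rightarrow> 'a \<Rightarrow> 4 \<Rightarrow> 'a" where
  "comp4 p q r s i = (if i = 1 then p else if i = 2 then q else if i = 3 then r else s)"

lemma comp4_simps [simp]:
  "comp4 p q r s 1 = p" "comp4 p q r s 2 = q" "comp4 p q r s 3 = r" "comp4 p q r s 4 = s"
  by (simp_all add: comp4_def)

text \<open>The components at a point, in terms of $c = \cos\theta$, $Q = \Delta_r$, $P = \Delta_\theta \sin^2\theta$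
  and the derivatives of $Q$ in $r$ and of $P$ in $c$. The inverses \<open>u\<close>, \<open>iQ\<close>, \<open>iP\<close> of $R = \rho^2$, $Q$, $P$
  are separate parameters, so that all entries are polynomials.\<close>

locale kn_point =
  fixes a r c R u Q Q1 Q2 iQ P P1 P2 iP :: real
begin

definition hh :: "4 \<Rightarrow> real" where
  "hh = comp4 (- (Q * u)) (R * iQ) (R * iP) (P * u)"

text \<open>The connection coefficients come from Koszul's formula; \<open>w_r\<close> and \<open>w_c\<close> are their derivatives
  in $r$ and $c$.\<close>

definition w :: "4 \<Rightarrow> 4 \<Rightarrow> 4 \<Rightarrow> real" where
  "w A B C =
     comp4 (comp4 (comp4 0 (- (r * u) + iQ * Q1 / 2) (- (a^2 * c * u)) 0)
         (comp4 (- (r * u) + iQ * Q1 / 2) 0 0 (a * r * u * iQ * P))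
         (comp4 (a^2 * c * u) 0 0 (- (a * c * u)))
         (comp4 0 (a * r * u * iQ * P) (a * c * u) 0) B)
      (comp4 (comp4 (- (r * u^3 * Q^2) + u^2 * Q * Q1 / 2) 0 0 (a * r * u^3 * Q * P))
         (comp4 0 (r * u - iQ * Q1 / 2) (a^2 * c * u) 0)
         (comp4 0 (a^2 * c * u) (- (r * u * Q * iP)) 0)
         (comp4 (a * r * u^3 * Q * P) 0 0 (- (r * u^3 * Q * P))) B)
      (comp4 (comp4 (a^2 * c * u^3 * Q * P) 0 0 (- (a * c * u^3 * Q * P)))
         (comp4 0 (- (a^2 * c * u * iQ * P)) (r * u) 0)
         (comp4 0 (r * u) (a^2 * c * u - iP * P1 / 2) 0)
         (comp4 (- (a * c * u^3 * Q * P)) 0 0 (a^2 * c * u^3 * P^2 - u^2 * P * P1 / 2)) B)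
      (comp4 (comp4 0 (a * r * u) (a * c * u * Q * iP) 0)
         (comp4 (- (a * r * u)) 0 0 (r * u))
         (comp4 (a * c * u * Q * iP) 0 0 (- (a^2 * c * u) + iP * P1 / 2))
         (comp4 0 (- (r * u)) (- (a^2 * c * u) + iP * P1 / 2) 0) B) A C"

definition w_r :: "4 \<Rightarrow> 4 \<Rightarrow> 4 \<Rightarrow> real" where
  "w_r A B C =
     comp4 (comp4 (comp4 0 (2 * r^2 * u^2 - u + iQ * Q2 / 2 - iQ^2 * Q1^2 / 2)
         (2 * a^2 * r * c * u^2) 0)
         (comp4 (2 * r^2 * u^2 - u + iQ * Q2 / 2 - iQ^2 * Q1^2 / 2) 0 0
             (- (2 * a * r^2 * u^2 * iQ * P) - a * r * u * iQ^2 * Q1 * P + a * u * iQ * P))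
         (comp4 (- (2 * a^2 * r * c * u^2)) 0 0 (2 * a * r * c * u^2))
         (comp4 0 (- (2 * a * r^2 * u^2 * iQ * P) - a * r * u * iQ^2 * Q1 * P + a * u * iQ * P)
             (- (2 * a * r * c * u^2)) 0) B)
      (comp4 (comp4 (6 * r^2 * u^4 * Q^2 - 4 * r * u^3 * Q * Q1 - u^3 * Q^2 + u^2 * Q * Q2 / 2
          + u^2 * Q1^2 / 2) 0 0 (- (6 * a * r^2 * u^4 * Q * P) + a * r * u^3 * Q1 * P
              + a * u^3 * Q * P))
         (comp4 0 (- (2 * r^2 * u^2) + u - iQ * Q2 / 2 + iQ^2 * Q1^2 / 2)
             (- (2 * a^2 * r * c * u^2)) 0)
         (comp4 0 (- (2 * a^2 * r * c * u^2)) (2 * r^2 * u^2 * Q * iP - r * u * Q1 * iP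
             - u * Q * iP) 0)
         (comp4 (- (6 * a * r^2 * u^4 * Q * P) + a * r * u^3 * Q1 * P + a * u^3 * Q * P) 0 0
             (6 * r^2 * u^4 * Q * P - r * u^3 * Q1 * P - u^3 * Q * P)) B)
      (comp4 (comp4 (- (6 * a^2 * r * c * u^4 * Q * P) + a^2 * c * u^3 * Q1 * P) 0 0
          (6 * a * r * c * u^4 * Q * P - a * c * u^3 * Q1 * P))
         (comp4 0 (2 * a^2 * r * c * u^2 * iQ * P + a^2 * c * u * iQ^2 * Q1 * P)
             (- (2 * r^2 * u^2) + u) 0)
         (comp4 0 (- (2 * r^2 * u^2) + u) (- (2 * a^2 * r * c * u^2)) 0)
         (comp4 (6 * a * r * c * u^4 * Q * P - a * c * u^3 * Q1 * P) 0 0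
             (- (6 * a^2 * r * c * u^4 * P^2) + 2 * r * u^3 * P * P1)) B)
      (comp4 (comp4 0 (- (2 * a * r^2 * u^2) + a * u)
          (- (2 * a * r * c * u^2 * Q * iP) + a * c * u * Q1 * iP) 0)
         (comp4 (2 * a * r^2 * u^2 - a * u) 0 0 (- (2 * r^2 * u^2) + u))
         (comp4 (- (2 * a * r * c * u^2 * Q * iP) + a * c * u * Q1 * iP) 0 0
             (2 * a^2 * r * c * u^2))
         (comp4 0 (2 * r^2 * u^2 - u) (2 * a^2 * r * c * u^2) 0) B) A C"

definition w_c :: "4 \<Rightarrow> 4 \<Rightarrow> 4 \<Rightarrow> real" where
  "w_c A B C =
     comp4 (comp4 (comp4 0 (2 * a^2 * r * c * u^2) (2 * a^4 * c^2 * u^2 - a^2 * u) 0)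
         (comp4 (2 * a^2 * r * c * u^2) 0 0 (- (2 * a^3 * r * c * u^2 * iQ * P)
             + a * r * u * iQ * P1))
         (comp4 (- (2 * a^4 * c^2 * u^2) + a^2 * u) 0 0 (2 * a^3 * c^2 * u^2 - a * u))
         (comp4 0 (- (2 * a^3 * r * c * u^2 * iQ * P) + a * r * u * iQ * P1)
             (- (2 * a^3 * c^2 * u^2) + a * u) 0) B)
      (comp4 (comp4 (6 * a^2 * r * c * u^4 * Q^2 - 2 * a^2 * c * u^3 * Q * Q1) 0 0
          (- (6 * a^3 * r * c * u^4 * Q * P) + a * r * u^3 * Q * P1))
         (comp4 0 (- (2 * a^2 * r * c * u^2)) (- (2 * a^4 * c^2 * u^2) + a^2 * u) 0)
         (comp4 0 (- (2 * a^4 * c^2 * u^2) + a^2 * u)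
             (2 * a^2 * r * c * u^2 * Q * iP + r * u * Q * iP^2 * P1) 0)
         (comp4 (- (6 * a^3 * r * c * u^4 * Q * P) + a * r * u^3 * Q * P1) 0 0
             (6 * a^2 * r * c * u^4 * Q * P - r * u^3 * Q * P1)) B)
      (comp4 (comp4 (- (6 * a^4 * c^2 * u^4 * Q * P) + a^2 * c * u^3 * Q * P1 + a^2 * u^3 * Q * P)
          0 0 (6 * a^3 * c^2 * u^4 * Q * P - a * c * u^3 * Q * P1 - a * u^3 * Q * P))
         (comp4 0 (2 * a^4 * c^2 * u^2 * iQ * P - a^2 * c * u * iQ * P1 - a^2 * u * iQ * P)
             (- (2 * a^2 * r * c * u^2)) 0)
         (comp4 0 (- (2 * a^2 * r * c * u^2)) (- (2 * a^4 * c^2 * u^2) + a^2 * u - iP * P2 / 2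
             + iP^2 * P1^2 / 2) 0)
         (comp4 (6 * a^3 * c^2 * u^4 * Q * P - a * c * u^3 * Q * P1 - a * u^3 * Q * P) 0 0
             (- (6 * a^4 * c^2 * u^4 * P^2) + 4 * a^2 * c * u^3 * P * P1 + a^2 * u^3 * P^2
                 - u^2 * P * P2 / 2 - u^2 * P1^2 / 2)) B)
      (comp4 (comp4 0 (- (2 * a^3 * r * c * u^2)) (- (2 * a^3 * c^2 * u^2 * Q * iP)
          - a * c * u * Q * iP^2 * P1 + a * u * Q * iP) 0)
         (comp4 (2 * a^3 * r * c * u^2) 0 0 (- (2 * a^2 * r * c * u^2)))
         (comp4 (- (2 * a^3 * c^2 * u^2 * Q * iP) - a * c * u * Q * iP^2 * P1 + a * u * Q * iP) 0 0
             (2 * a^4 * c^2 * u^2 - a^2 * u + iP * P2 / 2 - iP^2 * P1^2 / 2))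
         (comp4 0 (2 * a^2 * r * c * u^2) (2 * a^4 * c^2 * u^2 - a^2 * u + iP * P2 / 2
             - iP^2 * P1^2 / 2) 0) B) A C"

definition h_r :: "4 \<Rightarrow> real" where
  "h_r = comp4 (2 * r * u^2 * Q - u * Q1) (2 * r * iQ - R * iQ^2 * Q1) (2 * r * iP)
      (- (2 * r * u^2 * P))"

definition h_c :: "4 \<Rightarrow> real" where
  "h_c = comp4 (2 * a^2 * c * u^2 * Q) (2 * a^2 * c * iQ) (2 * a^2 * c * iP - R * iP^2 * P1)
     (u * P1 - 2 * a^2 * c * u^2 * P)"

definition anholonomy :: "4 \<Rightarrow> 4 \<Rightarrow> 4 \<Rightarrow> real" where
  "anholonomy A C D =
     comp4 (comp4 (comp4 0 0 (- (2 * a^2 * c * u)) 0) (comp4 0 0 0 0)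
              (comp4 (2 * a^2 * c * u) 0 0 (- (2 * a * c * u))) (comp4 0 0 (2 * a * c * u) 0) C)
       (\<lambda>_. 0) (\<lambda>_. 0)
       (comp4 (comp4 0 (2 * a * r * u) 0 0) (comp4 (- (2 * a * r * u)) 0 0 (2 * r * u))
              (comp4 0 0 0 0) (comp4 0 (- (2 * r * u)) 0 0) C) A D"

definition riem :: "4 \<Rightarrow> 4 \<Rightarrow> 4 \<Rightarrow> 4 \<Rightarrow> real" where
  "riem A B C D =
     comp4 0 (w_r A B D) (w_c A B D) 0 C - comp4 0 (w_r A B C) (w_c A B C) 0 D
     + (\<Sum>L\<in>UNIV. w A B L * (w L C D - w L D C) + w A L C * w L B D - w A L D * w L B C)"

definition plane12 :: "4 \<Rightarrow> 4 \<Rightarrow> real" where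
  "plane12 A B = (if A = 1 \<and> B = 2 then 1 else if A = 2 \<and> B = 1 then -1 else 0)"

definition plane34 :: "4 \<Rightarrow> 4 \<Rightarrow> real" where
  "plane34 A B = (if A = 3 \<and> B = 4 then 1 else if A = 4 \<and> B = 3 then -1 else 0)"

text \<open>In the normalised frame a tensor of this shape has sectional curvatures \<open>k12\<close>, \<open>k34\<close> and,
  for the four mixed planes, \<open>k\<close>; the coefficient \<open>b\<close> is that of the volume form, distributed according to
  the first Bianchi identity.\<close>

definition typeD :: "real \<Rightarrow> real \<Rightarrow> real \<Rightarrow> real \<Rightarrow> 4 \<Rightarrow> 4 \<Rightarrow> 4 \<Rightarrow> 4 \<Rightarrow> real" where
  "typeD k12 k k34 b A B C D =
     hh A * hh B * comp4 (comp4 0 k12 k k) (comp4 k12 0 k k) (comp4 k k 0 k34) (comp4 k k k34 0) A B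
       * ((if A = C \<and> B = D then 1 else 0) - (if A = D \<and> B = C then 1 else 0))
     + b * (plane12 A B * plane34 C D + plane34 A B * plane12 C D)
     + b / 2 * (plane12 A C * plane34 B D - plane12 A D * plane34 B C
              + plane34 A C * plane12 B D - plane34 A D * plane12 B C)"

text \<open>These expressions are for a general function $Q$ of $r$ and $P$ of $c$: the type D shape
  belongs to the whole Carter family, not to the particular quartics.\<close>

definition "k12 = - (4 * a^4 * c^2 * u^3 * P) + 4 * a^2 * c^2 * u^3 * Q + 3 * a^2 * u^2 * P
    + 2 * r * u^2 * Q1 - 3 * u^2 * Q - u * Q2 / 2"

definition "k34 = - (4 * a^4 * c^2 * u^3 * P) + 4 * a^2 * c^2 * u^3 * Q + 2 * a^2 * c * u^2 * P1
    + a^2 * u^2 * P - u^2 * Q - u * P2 / 2"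

definition "k13 = 2 * a^4 * c^2 * u^3 * P - 2 * a^2 * c^2 * u^3 * Q - a^2 * c * u^2 * P1 / 2
    - a^2 * u^2 * P - r * u^2 * Q1 / 2 + u^2 * Q"

definition "twist = 4 * a^3 * r * c * u^3 * P - 4 * a * r * c * u^3 * Q - a * r * u^2 * P1
    + a * c * u^2 * Q1"

definition ric :: "4 \<Rightarrow> 4 \<Rightarrow> real" where
  "ric B D = (\<Sum>A\<in>UNIV. riem A B A D)"

definition scal :: real where "scal = (\<Sum>A\<in>UNIV. ric A A / hh A)"

definition "eta A B = (if A = B then hh A else 0)"

definition weyl_pt :: "4 \<Rightarrow> 4 \<Rightarrow> 4 \<Rightarrow> 4 \<Rightarrow> real" where
  "weyl_pt A B C D = hh A * riem A B C D
     - 1 / 2 * (eta A C * ric B D - eta A D * ric B C - ric A D * eta B C + ric A C * eta B D)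
     + scal / 6 * (eta A C * eta B D - eta A D * eta B C)"

text \<open>What is left of the sectional curvature \<open>k12\<close>, and equally of
  \<open>k34\<close>, after removing the Ricci part.\<close>

definition "psi = (k12 + k34 - 2 * k13) / 3"

section \<open>Verification of the structure equations and of the type D form\<close>

context
  assumes R: "R = r^2 + a^2 * c^2" and nz: "R \<noteq> 0" "Q \<noteq> 0" "P \<noteq> 0"
    and inv: "u = 1 / R" "iQ = 1 / Q" "iP = 1 / P"
begin

lemma hh_nonzero: "hh A \<noteq> 0"
  unfolding hh_def using exhaust_4[of A] nz by (auto simp: inv)

lemma hh_prod: "hh 1 * hh 2 = -1" "hh 3 * hh 4 = 1"
  unfolding hh_def using nz by (simp_all add: inv)

lemma compat:
  "(if A = B then comp4 0 (h_r A) (h_c A) 0 C else 0) = hh A * w A B C + hh B * w B A C"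
proof -
  have "\<forall>A B C. (if A = B then comp4 0 (h_r A) (h_c A) 0 C else 0) = hh A * w A B C
      + hh B * w B A C"
    \<comment> \<open>Each of the 64 cases is cleared of denominators; after \<open>R\<close> is
      replaced by its polynomial a ring identity remains.\<close>
    by (simp only: forall_4, intro conjI;
      (simp add: hh_def h_r_def h_c_def w_def)?; (simp add: inv nz field_simps)?;
          (simp only: R)?; algebra?)
  then show ?thesis by blast
qed

lemma torsion: "w A C D - w A D C = anholonomy A C D"
proof -
  have "\<forall>A C D. w A C D - w A D C = anholonomy A C D"
    by (simp only: forall_4, intro conjI; (simp add: w_def anholonomy_def)?;
        (simp add: inv nz field_simps)?)
  then show ?thesis by blast
qed

text \<open>Antisymmetry in the last two indices leaves six pairs to check by computation, one per
  lemma.\<close>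

lemma riem_12: "\<forall>A B. hh A * riem A B 1 2 = typeD k12 k13 k34 twist A B 1 2"
  by (simp only: forall_4, intro conjI;
    (simp add: riem_def sum_4 typeD_def plane12_def plane34_def w_def w_r_def w_c_def hh_def
        k12_def k13_def k34_def twist_def)?;
    (simp add: inv nz field_simps)?; (simp only: R)?; algebra?)

lemma riem_13: "\<forall>A B. hh A * riem A B 1 3 = typeD k12 k13 k34 twist A B 1 3"
  by (simp only: forall_4, intro conjI;
    (simp add: riem_def sum_4 typeD_def plane12_def plane34_def w_def w_r_def w_c_def hh_def
        k12_def k13_def k34_def twist_def)?;
    (simp add: inv nz field_simps)?; (simp only: R)?; algebra?)

lemma riem_14: "\<forall>A B. hh A * riem A B 1 4 = typeD k12 k13 k34 twist A B 1 4"
  by (simp only: forall_4, intro conjI;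
    (simp add: riem_def sum_4 typeD_def plane12_def plane34_def w_def w_r_def w_c_def hh_def
        k12_def k13_def k34_def twist_def)?;
    (simp add: inv nz field_simps)?; (simp only: R)?; algebra?)

lemma riem_23: "\<forall>A B. hh A * riem A B 2 3 = typeD k12 k13 k34 twist A B 2 3"
  by (simp only: forall_4, intro conjI;
    (simp add: riem_def sum_4 typeD_def plane12_def plane34_def w_def w_r_def w_c_def hh_def
        k12_def k13_def k34_def twist_def)?;
    (simp add: inv nz field_simps)?; (simp only: R)?; algebra?)

lemma riem_24: "\<forall>A B. hh A * riem A B 2 4 = typeD k12 k13 k34 twist A B 2 4"
  by (simp only: forall_4, intro conjI;
    (simp add: riem_def sum_4 typeD_def plane12_def plane34_def w_def w_r_def w_c_def hh_def
        k12_def k13_def k34_def twist_def)?;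
    (simp add: inv nz field_simps)?; (simp only: R)?; algebra?)

lemma riem_34: "\<forall>A B. hh A * riem A B 3 4 = typeD k12 k13 k34 twist A B 3 4"
  by (simp only: forall_4, intro conjI;
    (simp add: riem_def sum_4 typeD_def plane12_def plane34_def w_def w_r_def w_c_def hh_def
        k12_def k13_def k34_def twist_def)?;
    (simp add: inv nz field_simps)?; (simp only: R)?; algebra?)

lemma riem_antisym: "riem A B D C = - riem A B C D"
  by (simp add: riem_def sum_negf[symmetric] sum.distrib sum_subtractf algebra_simps)

lemma plane_antisym: "plane12 B A = - plane12 A B" "plane34 B A = - plane34 A B"
  by (auto simp: plane12_def plane34_def)

lemma typeD_antisym: "typeD k l n b A B D C = - typeD k l n b A B C D"
  by (simp add: typeD_def plane_antisym[of D C] algebra_simps)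

lemma riem_eq: "hh A * riem A B C D = typeD k12 k13 k34 twist A B C D"
proof -
  have swap: "hh A * riem A B D C = typeD k12 k13 k34 twist A B D C"
    if "hh A * riem A B C D = typeD k12 k13 k34 twist A B C D" for C D
    using that by (simp add: riem_antisym[of A B D C] typeD_antisym[of _ _ _ _ A B D C])
  have diag: "hh A * riem A B C C = typeD k12 k13 k34 twist A B C C" for C
    using riem_antisym[of A B C C] typeD_antisym[of k12 k13 k34 twist A B C C] by simp
  note pairs = riem_12[rule_format] riem_13[rule_format] riem_14[rule_format]
    riem_23[rule_format] riem_24[rule_format] riem_34[rule_format]
  have "\<forall>C D. hh A * riem A B C D = typeD k12 k13 k34 twist A B C D"
    by (simp only: forall_4 diag pairs pairs[THEN swap] simp_thms)
  then show ?thesis by blast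
qed

text \<open>The \<open>twist\<close> part lives on components with four distinct indices and has no
  trace. Each direction lies in one of the planes (1,2), (3,4) and in two mixed planes.\<close>

lemma ric_eq: "ric B D = (if B = D then hh B * comp4 (k12 + 2 * k13) (k12 + 2 * k13)
    (k34 + 2 * k13) (k34 + 2 * k13) B else 0)"
proof -
  have "riem A B A D = typeD k12 k13 k34 twist A B A D / hh A" for A
    using riem_eq[of A B A D] hh_nonzero[of A] by (simp add: field_simps)
  then have "ric B D = (\<Sum>A\<in>UNIV. typeD k12 k13 k34 twist A B A D / hh A)"
    by (simp add: ric_def)
  moreover have "\<forall>B D. (\<Sum>A\<in>UNIV. typeD k12 k13 k34 twist A B A D / hh A)
    = (if B = D then hh B * comp4 (k12 + 2 * k13) (k12 + 2 * k13) (k34 + 2 * k13)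
        (k34 + 2 * k13) B else 0)"
    by (simp only: forall_4, intro conjI)
      (simp_all add: sum_4 typeD_def plane12_def plane34_def hh_nonzero algebra_simps)
  ultimately show ?thesis by simp
qed

lemma scal_eq: "scal = 2 * (k12 + k34 + 4 * k13)"
  by (simp add: scal_def ric_eq sum_4 hh_nonzero)

text \<open>Trace-freeness forces the mixed planes to carry \<open>- psi / 2\<close>. The
  \<open>twist\<close> part is trace-free already and passes through unchanged.\<close>

lemma weyl_pt_eq: "weyl_pt A B C D = typeD psi (- psi / 2) psi twist A B C D"
proof -
  have "\<forall>A B C D. weyl_pt A B C D = typeD psi (- psi / 2) psi twist A B C D"
    unfolding weyl_pt_def riem_eq scal_eq
    by (simp only: forall_4, intro conjI;
      (simp add: typeD_def plane12_def plane34_def eta_def ric_eq psi_def)?;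
          (simp add: field_simps)?)
  then show ?thesis by blast
qed

lemma weyl_pt_square:
  "(\<Sum>D\<in>UNIV. \<Sum>C\<in>UNIV. \<Sum>B\<in>UNIV. \<Sum>A\<in>UNIV. (weyl_pt A B C D)\<^sup>2 / (hh A * hh B * hh C * hh D))
    = 12 * (psi^2 - twist^2)"
proof -
  have 1: "hh 2 = - 1 / hh 1" "hh 4 = 1 / hh 3"
    using hh_prod hh_nonzero[of 1] hh_nonzero[of 3] by (simp_all add: field_simps)
  show ?thesis
    by (simp add: weyl_pt_eq sum_4 typeD_def plane12_def plane34_def 1)
      (simp add: hh_nonzero field_simps power2_eq_square)
qed

end

end

text \<open>The chain rule along a curve with velocity $(r', c')$, which certifies
  \<open>w_r\<close> and \<open>w_c\<close> as the partial derivatives of \<open>w\<close>. As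
  \<open>w\<close> is polynomial in its arguments, the inverses enter only through their own
  derivatives.\<close>

lemma kn_w_derivative:
  fixes f\<rho> f\<gamma> :: "real \<Rightarrow> real"
  assumes "(f\<rho> has_field_derivative r') (at 0)" "(f\<gamma> has_field_derivative c') (at 0)"
    and "(fu has_field_derivative (- (u^2) * (2 * r * r' + 2 * a^2 * c * c'))) (at 0)"
    and "(fQ has_field_derivative (Q1 * r')) (at 0)" "(fQ1 has_field_derivative (Q2 * r')) (at 0)"
    and "(fiQ has_field_derivative (- (iQ^2) * Q1 * r')) (at 0)"
    and "(fP has_field_derivative (P1 * c')) (at 0)" "(fP1 has_field_derivative (P2 * c')) (at 0)"
    and "(fiP has_field_derivative (- (iP^2) * P1 * c')) (at 0)"
    and "f\<rho> 0 = r" "f\<gamma> 0 = c" "fu 0 = u" "fQ 0 = Q" "fQ1 0 = Q1" "fiQ 0 = iQ" "fP 0 = P" "fP1 0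
        = P1"
      "fiP 0 = iP"
  shows "((\<lambda>s. kn_point.w a (f\<rho> s) (f\<gamma> s) (fu s) (fQ s) (fQ1 s) (fiQ s) (fP s) (fP1 s)
      (fiP s) A B C)
    has_field_derivative (r' * kn_point.w_r a r c u Q Q1 Q2 iQ P P1 iP A B C
        + c' * kn_point.w_c a r c u Q Q1 iQ P P1 P2 iP A B C)) (at 0)"
proof -
  have "\<forall>A B C. ((\<lambda>s. kn_point.w a (f\<rho> s) (f\<gamma> s) (fu s) (fQ s) (fQ1 s) (fiQ s) (fP s) (fP1 s)
      (fiP s) A B C)
    has_field_derivative (r' * kn_point.w_r a r c u Q Q1 Q2 iQ P P1 iP A B C
        + c' * kn_point.w_c a r c u Q Q1 iQ P P1 P2 iP A B C)) (at 0)"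
    by (simp only: forall_4, intro conjI;
      (simp only: kn_point.w_def kn_point.w_r_def kn_point.w_c_def comp4_simps);
      ((auto intro!: derivative_eq_intros assms(1-9)[THEN DERIV_cong] simp: assms(10-))[1])?;
      (simp add: numeral_eq_Suc)?; (simp add: field_simps)?; algebra?)
  then show ?thesis by blast
qed

section \<open>The Kerr-Newman-(anti-)de Sitter spacetime\<close>

locale kn_spacetime =
  fixes a m q \<Lambda> :: real
  assumes Xi: "kn_Xi a \<Lambda> \<noteq> 0"
begin

abbreviation "chart \<equiv> kn_domain a m q \<Lambda>"

section \<open>Metric functions and Carter frame on the chart\<close>

definition R :: "real^4 \<Rightarrow> real" where "R x = (x $ 2)^2 + a^2 * (cos (x $ 3))^2"

definition Q :: "real^4 \<Rightarrow> real" where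
  "Q x = (x $ 2)^2 + a^2 - \<Lambda> / 3 * (x $ 2)^4 - \<Lambda> / 3 * a^2 * (x $ 2)^2 - 2 * m * (x $ 2) + q^2"

definition Q1 :: "real^4 \<Rightarrow> real" where
  "Q1 x = 2 * (x $ 2) - 4 * (\<Lambda> / 3) * (x $ 2)^3 - 2 * (\<Lambda> / 3) * a^2 * (x $ 2) - 2 * m"

definition Q2 :: "real^4 \<Rightarrow> real" where
  "Q2 x = 2 - 12 * (\<Lambda> / 3) * (x $ 2)^2 - 2 * (\<Lambda> / 3) * a^2"

definition P :: "real^4 \<Rightarrow> real" where
  "P x = 1 + (a^2 * (\<Lambda> / 3) - 1) * (cos (x $ 3))^2 - a^2 * (\<Lambda> / 3) * (cos (x $ 3))^4"

definition P1 :: "real^4 \<Rightarrow> real" where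
  "P1 x = 2 * (a^2 * (\<Lambda> / 3) - 1) * (cos (x $ 3)) - 4 * (a^2 * (\<Lambda> / 3)) * (cos (x $ 3))^3"

definition P2 :: "real^4 \<Rightarrow> real" where
  "P2 x = 2 * (a^2 * (\<Lambda> / 3) - 1) - 12 * (a^2 * (\<Lambda> / 3)) * (cos (x $ 3))^2"

lemma Q_eq: "kn_Delta_r a m q \<Lambda> (x $ 2) = Q x"
  by (simp add: kn_Delta_r_def Q_def algebra_simps power2_eq_square power4_eq_xxxx)

lemma P_eq: "kn_Delta_theta a \<Lambda> (x $ 3) * (sin (x $ 3))^2 = P x"
  unfolding kn_Delta_theta_def P_def sin_squared_eq
  by (simp add: field_simps power2_eq_square power4_eq_xxxx)

lemma R_eq: "kn_rho2 a (x $ 2) (x $ 3) = R x"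
  by (simp add: kn_rho2_def R_def)

lemma sin_nonzero: "x \<in> chart \<Longrightarrow> sin (x $ 3) \<noteq> 0"
  using sin_gt_zero[of "x $ 3"] by (auto simp: kn_domain_def)

lemma nonzero:
  assumes "x \<in> chart"
  shows "R x \<noteq> 0" "Q x \<noteq> 0" "P x \<noteq> 0"
  using assms sin_nonzero[OF assms] unfolding R_eq[symmetric] Q_eq[symmetric] P_eq[symmetric]
  by (auto simp: kn_domain_def)

lemma open_chart: "open chart"
proof -
  have "chart = {x. 0 < x $ 3} \<inter> {x. x $ 3 < pi} \<inter> {x. R x \<noteq> 0} \<inter> {x. Q x \<noteq> 0}
      \<inter> {x. kn_Delta_theta a \<Lambda> (x $ 3) \<noteq> 0}"
    by (auto simp: kn_domain_def R_eq Q_eq)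
  also have "open \<dots>"
    unfolding R_def Q_def kn_Delta_theta_def
    by (intro open_Int open_Collect_less open_Collect_neq continuous_intros)
  finally show ?thesis .
qed

definition h :: "4 \<Rightarrow> real^4 \<Rightarrow> real" where
  "h A x = kn_point.hh (R x) (1 / R x) (Q x) (1 / Q x) (P x) (1 / P x) A"

definition dh :: "4 \<Rightarrow> 4 \<Rightarrow> real^4 \<Rightarrow> real" where
  "dh C A x = comp4 0
     (kn_point.h_r (x $ 2) (R x) (1 / R x) (Q x) (Q1 x) (1 / Q x) (P x) (1 / P x) A)
     (kn_point.h_c a (cos (x $ 3)) (R x) (1 / R x) (Q x) (1 / Q x) (P x) (P1 x) (1 / P x) A) 0 C"

definition w :: "4 \<Rightarrow> 4 \<Rightarrow> 4 \<Rightarrow> real^4 \<Rightarrow> real" where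
  "w A B C x = kn_point.w a (x $ 2) (cos (x $ 3)) (1 / R x) (Q x) (Q1 x) (1 / Q x) (P x) (P1 x)
      (1 / P x) A B C"

definition dw :: "4 \<Rightarrow> 4 \<Rightarrow> 4 \<Rightarrow> 4 \<Rightarrow> real^4 \<Rightarrow> real" where
  "dw D A B C x = comp4 0
     (kn_point.w_r a (x $ 2) (cos (x $ 3)) (1 / R x) (Q x) (Q1 x) (Q2 x) (1 / Q x) (P x) (P1 x)
         (1 / P x) A B C)
     (kn_point.w_c a (x $ 2) (cos (x $ 3)) (1 / R x) (Q x) (Q1 x) (1 / Q x) (P x) (P1 x) (P2 x)
         (1 / P x) A B C)
     0 D"

abbreviation "\<Xi> \<equiv> kn_Xi a \<Lambda>"

definition E :: "4 \<Rightarrow> 4 \<Rightarrow> real^4 \<Rightarrow> real" where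
  "E A i x = comp4 (comp4 (1 / \<Xi>) 0 0 (- (a * (1 - (cos (x $ 3))^2) / \<Xi>)))
     (comp4 0 1 0 0) (comp4 0 0 (- sin (x $ 3)) 0)
     (comp4 (a / \<Xi>) 0 0 (- (((x $ 2)^2 + a^2) / \<Xi>))) A i"

definition dE :: "4 \<Rightarrow> 4 \<Rightarrow> 4 \<Rightarrow> real^4 \<Rightarrow> real" where
  "dE i A j x =
     (if i = 2 \<and> A = 4 \<and> j = 4 then - (2 * x $ 2 / \<Xi>)
      else if i = 3 \<and> A = 1 \<and> j = 4 then - (2 * a * cos (x $ 3) * sin (x $ 3) / \<Xi>)
      else if i = 3 \<and> A = 3 \<and> j = 3 then - cos (x $ 3) else 0)"

definition ddE :: "4 \<Rightarrow> 4 \<Rightarrow> 4 \<Rightarrow> 4 \<Rightarrow> real^4 \<Rightarrow> real" where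
  "ddE i j A k x =
     (if i = 2 \<and> j = 2 \<and> A = 4 \<and> k = 4 then - (2 / \<Xi>)
      else if i = 3 \<and> j = 3 \<and> A = 1 \<and> k = 4 then - (2 * a * ((cos (x $ 3))^2 - (sin (x $ 3))^2) / \<Xi>)
      else if i = 3 \<and> j = 3 \<and> A = 3 \<and> k = 3 then sin (x $ 3) else 0)"

definition F :: "4 \<Rightarrow> 4 \<Rightarrow> real^4 \<Rightarrow> real" where
  "F i A x = comp4
     (comp4 (\<Xi> * ((x $ 2)^2 + a^2) / R x) 0 0 (- (\<Xi> * a * (1 - (cos (x $ 3))^2) / R x)))
     (comp4 0 1 0 0) (comp4 0 0 (- (1 / sin (x $ 3))) 0)
     (comp4 (\<Xi> * a / R x) 0 0 (- (\<Xi> / R x))) i A"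

lemma metric_frame:
  assumes "x \<in> chart"
  shows "kn_metric a m q \<Lambda> x $ i $ j = (\<Sum>A\<in>UNIV. h A x * E A i x * E A j x)"
proof -
  have th: "P x = kn_Delta_theta a \<Lambda> (x $ 3) * (sin (x $ 3))^2" by (rule P_eq[symmetric])
  have "\<forall>i j. kn_metric a m q \<Lambda> x $ i $ j = (\<Sum>A\<in>UNIV. h A x * E A i x * E A j x)"
    unfolding kn_metric_def Let_def Q_eq R_eq h_def kn_point.hh_def
    using nonzero[OF assms] Xi sin_nonzero[OF assms]
    by (simp only: forall_4, intro conjI;
      (simp add: sum_4 E_def covector_square_def axis_def th)?;
      (simp add: field_simps)?; (use sin_squared_eq[of "x $ 3"] in algebra)?;
          (simp add: power2_eq_square)?)
  then show ?thesis by blast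
qed

lemma dual_frame:
  assumes "x \<in> chart"
  shows "(\<Sum>i\<in>UNIV. E A i x * F i B x) = (if A = B then 1 else 0)"
proof -
  have "\<forall>A B. (\<Sum>i\<in>UNIV. E A i x * F i B x) = (if A = B then 1 else 0)"
    using nonzero[OF assms] Xi sin_nonzero[OF assms]
    by (simp only: forall_4, intro conjI;
      (simp add: sum_4 E_def F_def)?; (simp add: field_simps)?; (simp only: R_def)?; algebra?)
  then show ?thesis by blast
qed

lemma line_coord: "(x + s *\<^sub>R axis i 1) $ j = x $ j + s * (if j = i then 1 else 0)"
  by (simp add: axis_def)

lemma deriv_E:
  "has_pderiv (E A j) (dE i A j x) i x"
proof -
  have "\<forall>i A j. has_pderiv (E A j) (dE i A j x) i x"
    unfolding has_pderiv_def E_def line_coord dE_def using Xi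
    by (simp only: forall_4, intro conjI; simp?;
       auto intro!: derivative_eq_intros simp: field_simps)
  then show ?thesis by blast
qed

lemma deriv_dE:
  "has_pderiv (dE j A k) (ddE i j A k x) i x"
proof -
  have "\<forall>i j A k. has_pderiv (dE j A k) (ddE i j A k x) i x"
    unfolding has_pderiv_def dE_def line_coord ddE_def using Xi
    by (simp only: forall_4, intro conjI; simp?;
       auto intro!: derivative_eq_intros simp: field_simps power2_eq_square)
  then show ?thesis by blast
qed

lemma basic_derivs:
  assumes "x \<in> chart"
  defines "p \<equiv> \<lambda>i s. x + s *\<^sub>R axis i 1"
  defines "r' \<equiv> \<lambda>i. E 2 i x" and "c' \<equiv> \<lambda>i. E 3 i x"
  shows "((\<lambda>s. p i s $ 2) has_field_derivative r' i) (at 0)"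
    and "((\<lambda>s. cos (p i s $ 3)) has_field_derivative c' i) (at 0)"
    and "((\<lambda>s. R (p i s)) has_field_derivative (2 * x $ 2 * r' i + 2 * a^2 * cos (x $ 3) * c' i))
        (at 0)"
    and "((\<lambda>s. 1 / R (p i s)) has_field_derivative
      (- ((1 / R x)^2) * (2 * x $ 2 * r' i + 2 * a^2 * cos (x $ 3) * c' i))) (at 0)"
    and "((\<lambda>s. Q (p i s)) has_field_derivative (Q1 x * r' i)) (at 0)"
    and "((\<lambda>s. Q1 (p i s)) has_field_derivative (Q2 x * r' i)) (at 0)"
    and "((\<lambda>s. 1 / Q (p i s)) has_field_derivative (- ((1 / Q x)^2) * Q1 x * r' i)) (at 0)"
    and "((\<lambda>s. P (p i s)) has_field_derivative (P1 x * c' i)) (at 0)"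
    and "((\<lambda>s. P1 (p i s)) has_field_derivative (P2 x * c' i)) (at 0)"
    and "((\<lambda>s. 1 / P (p i s)) has_field_derivative (- ((1 / P x)^2) * P1 x * c' i)) (at 0)"
proof -
  show r: "((\<lambda>s. p i s $ 2) has_field_derivative r' i) (at 0)"
    using exhaust_4[of i] unfolding p_def line_coord r'_def E_def
    by (auto intro!: derivative_eq_intros)
  show c: "((\<lambda>s. cos (p i s $ 3)) has_field_derivative c' i) (at 0)"
    using exhaust_4[of i] unfolding p_def line_coord c'_def E_def
    by (auto intro!: derivative_eq_intros)
  have p0: "p i 0 = x" by (simp add: p_def)
  note rc = r[THEN DERIV_cong] c[THEN DERIV_cong]
  show R': "((\<lambda>s. R (p i s)) has_field_derivative (2 * x $ 2 * r' i + 2 * a^2 * cos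
      (x $ 3) * c' i)) (at 0)"
    unfolding R_def by (auto intro!: derivative_eq_intros rc simp: p0)
  show Q': "((\<lambda>s. Q (p i s)) has_field_derivative (Q1 x * r' i)) (at 0)"
    unfolding Q_def Q1_def by (auto intro!: derivative_eq_intros rc simp: p0 field_simps)
  show P': "((\<lambda>s. P (p i s)) has_field_derivative (P1 x * c' i)) (at 0)"
    unfolding P_def P1_def by (auto intro!: derivative_eq_intros rc simp: p0 field_simps)
  show "((\<lambda>s. Q1 (p i s)) has_field_derivative (Q2 x * r' i)) (at 0)"
    unfolding Q1_def Q2_def by (auto intro!: derivative_eq_intros rc simp: p0 field_simps)
  show "((\<lambda>s. P1 (p i s)) has_field_derivative (P2 x * c' i)) (at 0)"
    unfolding P1_def P2_def by (auto intro!: derivative_eq_intros rc simp: p0 field_simps)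
  show "((\<lambda>s. 1 / R (p i s)) has_field_derivative
      (- ((1 / R x)^2) * (2 * x $ 2 * r' i + 2 * a^2 * cos (x $ 3) * c' i))) (at 0)"
    using nonzero[OF assms(1)]
    by (auto intro!: derivative_eq_intros R'[THEN DERIV_cong] simp: p0 power2_eq_square field_simps)
  show "((\<lambda>s. 1 / Q (p i s)) has_field_derivative (- ((1 / Q x)^2) * Q1 x * r' i)) (at 0)"
    using nonzero[OF assms(1)]
    by (auto intro!: derivative_eq_intros Q'[THEN DERIV_cong] simp: p0 power2_eq_square field_simps)
  show "((\<lambda>s. 1 / P (p i s)) has_field_derivative (- ((1 / P x)^2) * P1 x * c' i)) (at 0)"
    using nonzero[OF assms(1)]
    by (auto intro!: derivative_eq_intros P'[THEN DERIV_cong] simp: p0 power2_eq_square field_simps)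
qed

lemma deriv_w:
  assumes "x \<in> chart"
  shows "has_pderiv (w A B C) (\<Sum>D\<in>UNIV. E D i x * dw D A B C x) i x"
proof -
  note b = basic_derivs[OF assms, of i]
  show ?thesis
    unfolding has_pderiv_def w_def
    using kn_w_derivative[OF b(1,2,4-10)]
    by (simp add: sum_4 dw_def)
qed

lemma deriv_h:
  assumes "x \<in> chart"
  shows "has_pderiv (h A) (\<Sum>C\<in>UNIV. E C i x * dh C A x) i x"
proof -
  note b = basic_derivs[OF assms, of i, THEN DERIV_cong]
  have "\<forall>A. has_pderiv (h A) (\<Sum>C\<in>UNIV. E C i x * dh C A x) i x"
    unfolding has_pderiv_def h_def kn_point.hh_def
    apply (simp only: forall_4 comp4_simps)
    apply (intro conjI)
    apply (auto intro!: derivative_eq_intros b simp: sum_4 dh_def kn_point.h_r_def kn_point.h_c_def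
        nonzero[OF assms] field_simps)
    apply (algebra | simp add: power2_eq_square)+
    done
  then show ?thesis by blast
qed

lemma deriv_F:
  assumes "x \<in> chart"
  shows "\<exists>D. has_pderiv (F i A) D j x"
proof -
  note b = basic_derivs[OF assms, of j]
  have p0: "x + 0 *\<^sub>R axis j 1 = x" by simp
  have "((\<lambda>s. sin ((x + s *\<^sub>R axis j 1) $ 3)) has_field_derivative
      (if j = 3 then cos (x $ 3) else 0)) (at 0)"
    unfolding line_coord by (cases "j = 3") (auto intro!: derivative_eq_intros)
  then have sd: "(\<lambda>s. sin ((x + s *\<^sub>R axis j 1) $ 3)) field_differentiable at 0"
    unfolding field_differentiable_def by blast
  have fdI: "(f has_field_derivative D) (at 0) \<Longrightarrow> f field_differentiable at 0" for f and D :: real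
    unfolding field_differentiable_def by blast
  note fd = sd b(1-3)[THEN fdI]
  have "\<forall>i A. (\<lambda>s. F i A (x + s *\<^sub>R axis j 1)) field_differentiable at 0"
    unfolding F_def
    apply (simp only: forall_4 comp4_simps)
    apply (intro conjI)
    apply (auto intro!: derivative_intros fd simp: p0 nonzero[OF assms] sin_nonzero[OF assms]
        simp del: vector_add_component vector_scaleR_component)
    done
  then have "\<forall>i A. \<exists>D. has_pderiv (F i A) D j x"
    by (simp add: has_pderiv_def field_differentiable_def)
  then show ?thesis by blast
qed

text \<open>The last three instantiate the assumptions of \<^locale>\<open>kn_point\<close> on \<open>u\<close>, \<open>iQ\<close> and \<open>iP\<close>.\<close>

lemma point_facts:
  assumes "x \<in> chart"
  shows "R x = (x $ 2)^2 + a^2 * (cos (x $ 3))^2" "R x \<noteq> 0" "Q x \<noteq> 0" "P x \<noteq> 0"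
    "1 / R x = 1 / R x" "1 / Q x = 1 / Q x" "1 / P x = 1 / P x"
  using nonzero[OF assms] by (simp_all add: R_def)

lemma torsion_frame:
  assumes "x \<in> chart"
  shows "dE i A j x - dE j A i x
    = (\<Sum>C\<in>UNIV. \<Sum>D\<in>UNIV. (w A C D x - w A D C x) * E C i x * E D j x)"
proof -
  have "\<forall>i A j. dE i A j x - dE j A i x
      = (\<Sum>C\<in>UNIV. \<Sum>D\<in>UNIV. kn_point.anholonomy a (x $ 2) (cos (x $ 3))
          (1 / R x) A C D * E C i x * E D j x)"
    using nonzero(1)[OF assms] Xi
    by (simp only: forall_4, intro conjI;
      (simp add: sum_4 dE_def E_def kn_point.anholonomy_def)?;
      (simp add: field_simps)?; (simp only: R_def)?; algebra?)
  then show ?thesis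
    unfolding w_def kn_point.torsion[OF point_facts[OF assms]] by blast
qed

sublocale moving_frame "kn_metric a m q \<Lambda>" chart h dh E dE ddE F w dw
proof
  show "(if A = B then dh C A x else 0) = h A x * w A B C x + h B x * w B A C x" if
      "x \<in> chart" for x A B C
    using kn_point.compat[OF point_facts[OF that], of A B "Q1 x" "P1 x" C]
    by (simp add: dh_def h_def w_def cong: if_cong)
  show "h A x \<noteq> 0" if "x \<in> chart" for x A
    using kn_point.hh_nonzero[OF point_facts[OF that]] by (simp add: h_def)
qed (rule open_chart metric_frame dual_frame deriv_h deriv_E deriv_dE deriv_F deriv_w torsion_frame
     | assumption | simp add: ddE_def)+

section \<open>The two Weyl invariants\<close>

definition psi :: "real^4 \<Rightarrow> real" where
  "psi x = kn_point.psi a (x $ 2) (cos (x $ 3)) (1 / R x) (Q x) (Q1 x) (Q2 x) (P x) (P1 x) (P2 x)"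

definition twist :: "real^4 \<Rightarrow> real" where
  "twist x = kn_point.twist a (x $ 2) (cos (x $ 3)) (1 / R x) (Q x) (Q1 x) (P x) (P1 x)"

lemma frame_weyl_point:
  "frame_weyl x A B C D = kn_point.weyl_pt a (x $ 2) (cos (x $ 3)) (R x) (1 / R x) (Q x) (Q1 x)
      (Q2 x) (1 / Q x)
     (P x) (P1 x) (P2 x) (1 / P x) A B C D"
  by (simp add: frame_weyl_def kn_point.weyl_pt_def frame_metric_def frame_ricci_def
      frame_scalar_def
      kn_point.scal_def kn_point.ric_def kn_point.eta_def kn_point.riem_def frame_riem_def h_def
          w_def dw_def)

lemma weyl_square_psi:
  assumes "x \<in> chart"
  shows "weyl_square (kn_metric a m q \<Lambda>) x = 12 * ((psi x)^2 - (twist x)^2)"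
  unfolding weyl_square_eq[OF assms] frame_weyl_point h_def psi_def twist_def
  by (rule kn_point.weyl_pt_square[OF point_facts[OF assms]])

text \<open>Real and imaginary part of $(m z - q^2) z^2$ for $z = r + i a c$; by the next lemma
  \<open>psi\<close> and \<open>twist\<close> are, up to the factor $2 / \rho^6$, its real and imaginary part.\<close>

definition reZ :: "real \<Rightarrow> real \<Rightarrow> real" where
  "reZ r c = (m * r - q^2) * (r^2 - a^2 * c^2) - 2 * m * r * a^2 * c^2"

definition imZ :: "real \<Rightarrow> real \<Rightarrow> real" where
  "imZ r c = m * a * c * (r^2 - a^2 * c^2) + 2 * r * a * c * (m * r - q^2)"

lemma psi_twist_eq:
  assumes "x \<in> chart"
  shows "psi x = 2 * reZ (x $ 2) (cos (x $ 3)) * (1 / R x)^3"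
    and "twist x = 2 * imZ (x $ 2) (cos (x $ 3)) * (1 / R x)^3"
proof -
  define r c u l where "r = x $ 2" and "c = cos (x $ 3)" and "u = 1 / R x" and "l = \<Lambda> / 3"
  note defs = R_def[of x] Q_def[of x] Q1_def[of x] Q2_def[of x] P_def[of x] P1_def[of x]
      P2_def[of x]
  note folds = r_def[symmetric] c_def[symmetric] u_def[symmetric] l_def[symmetric]
  \<comment> \<open>With \<open>u\<close> kept as a symbol subject to this relation, the rational
    identities become polynomial ones.\<close>
  have u: "u * R x = 1"
    using nonzero(1)[OF assms] by (simp add: u_def)
  have "6 * (4 * a^2 * c^2 * (Q x - a^2 * P x) + R x *
      (2 * a^2 * P x + r * Q1 x - 2 * Q x + a^2 * c * P1 x))
      - (R x)^2 * (Q2 x + P2 x) = 12 * reZ r c"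
    unfolding defs reZ_def folds by algebra
  moreover have "psi x = (6 * (4 * a^2 * c^2 * (Q x - a^2 * P x) * u^3
       + u^2 * (2 * a^2 * P x + r * Q1 x - 2 * Q x + a^2 * c * P1 x)) - u * (Q2 x + P2 x)) / 6"
    unfolding psi_def kn_point.psi_def kn_point.k12_def kn_point.k13_def kn_point.k34_def folds
    by (simp add: field_simps)
  moreover have "6 * (4 * a^2 * c^2 * (Q x - a^2 * P x) * u^3
       + u^2 * (2 * a^2 * P x + r * Q1 x - 2 * Q x + a^2 * c * P1 x)) - u * (Q2 x + P2 x)
     = u^3 * (6 * (4 * a^2 * c^2 * (Q x - a^2 * P x) + R x *
         (2 * a^2 * P x + r * Q1 x - 2 * Q x + a^2 * c * P1 x))
      - (R x)^2 * (Q2 x + P2 x))"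
    using u by algebra
  ultimately have "psi x = 2 * reZ r c * u^3" by simp
  then show "psi x = 2 * reZ (x $ 2) (cos (x $ 3)) * (1 / R x)^3"
    by (simp only: r_def c_def u_def)
  have "4 * a * r * c * (a^2 * P x - Q x) + R x * (a * c * Q1 x - a * r * P1 x) = 2 * imZ r c"
    unfolding defs imZ_def folds by algebra
  moreover have "twist x = u^3 * (4 * a * r * c * (a^2 * P x - Q x) + R x *
      (a * c * Q1 x - a * r * P1 x))"
    unfolding twist_def kn_point.twist_def folds using u by algebra
  ultimately have "twist x = 2 * imZ r c * u^3" by simp
  then show "twist x = 2 * imZ (x $ 2) (cos (x $ 3)) * (1 / R x)^3"
    by (simp only: r_def c_def u_def)
qed

section \<open>The gradient of the Weyl square and the invariant $I_5$\<close>

definition reZ_r :: "real \<Rightarrow> real \<Rightarrow> real" where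
  "reZ_r r c = m * (r^2 - a^2 * c^2) + 2 * r * (m * r - q^2) - 2 * m * a^2 * c^2"

text \<open>Because $(m z - q^2) z^2$ is holomorphic in $z = r + i a c$, Cauchy-Riemann holds:
  \<open>reZ_c\<close> is $-a$ times \<open>imZ_r\<close>, and \<open>imZ_c\<close> is $a$ times
  \<open>reZ_r\<close>.\<close>

definition reZ_c :: "real \<Rightarrow> real \<Rightarrow> real" where
  "reZ_c r c = - (2 * a^2 * c * (m * r - q^2)) - 4 * m * r * a^2 * c"

definition imZ_r :: "real \<Rightarrow> real \<Rightarrow> real" where
  "imZ_r r c = 4 * m * a * c * r + 2 * a * c * (m * r - q^2)"

definition imZ_c :: "real \<Rightarrow> real \<Rightarrow> real" where
  "imZ_c r c = m * a * (r^2 - a^2 * c^2) - 2 * m * a^3 * c^2 + 2 * r * a * (m * r - q^2)"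

definition dW :: "(real \<Rightarrow> real \<Rightarrow> real) \<Rightarrow> (real \<Rightarrow> real \<Rightarrow> real) \<Rightarrow> real \<Rightarrow> real^4 \<Rightarrow> real" where
  "dW dA dB dR x = (let r = x $ 2; c = cos (x $ 3); u = 1 / R x in
     96 * (reZ r c * dA r c - imZ r c * dB r c) * u^6 - 288 *
         ((reZ r c)^2 - (imZ r c)^2) * dR * u^7)"

abbreviation "Wr x \<equiv> dW reZ_r imZ_r (2 * x $ 2) x"
abbreviation "Wc x \<equiv> dW reZ_c imZ_c (2 * a^2 * cos (x $ 3)) x"

lemma weyl_square_kn:
  assumes "x \<in> chart"
  shows "weyl_square (kn_metric a m q \<Lambda>) x
    = 48 * ((reZ (x $ 2) (cos (x $ 3)))^2 - (imZ (x $ 2) (cos (x $ 3)))^2) * (1 / R x)^6"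
  unfolding weyl_square_psi[OF assms] psi_twist_eq[OF assms]
  by (simp add: algebra_simps power_mult_distrib flip: power_mult)

lemma deriv_weyl_square:
  assumes "x \<in> chart"
  shows "has_pderiv (weyl_square (kn_metric a m q \<Lambda>))
      (\<Sum>C\<in>UNIV. E C i x * comp4 0 (Wr x) (Wc x) 0 C) i x"
proof -
  note b = basic_derivs(1,2,4)[OF assms, of i, THEN DERIV_cong]
  let ?p = "\<lambda>s. x + s *\<^sub>R axis i 1"
  let ?A = "\<lambda>s. reZ (?p s $ 2) (cos (?p s $ 3))" and ?B = "\<lambda>s. imZ (?p s $ 2) (cos (?p s $ 3))"
  have p0: "?p 0 = x" by simp
  have A: "(?A has_field_derivative (reZ_r (x $ 2) (cos (x $ 3)) * E 2 i x + reZ_c (x $ 2)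
      (cos (x $ 3)) * E 3 i x)) (at 0)"
    unfolding reZ_def reZ_r_def reZ_c_def
    by (auto intro!: derivative_eq_intros b simp: p0 simp del: vector_add_component
        vector_scaleR_component)
      (simp add: algebra_simps power2_eq_square)
  have B: "(?B has_field_derivative (imZ_r (x $ 2) (cos (x $ 3)) * E 2 i x + imZ_c (x $ 2)
      (cos (x $ 3)) * E 3 i x)) (at 0)"
    unfolding imZ_def imZ_r_def imZ_c_def
    by (auto intro!: derivative_eq_intros b simp: p0 simp del: vector_add_component
        vector_scaleR_component)
      (simp add: algebra_simps power2_eq_square power3_eq_cube)
  have "has_pderiv (\<lambda>x. 48 * ((reZ (x $ 2) (cos (x $ 3)))^2 - (imZ (x $ 2) (cos (x $ 3)))^2) *
      (1 / R x)^6)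
    (\<Sum>C\<in>UNIV. E C i x * comp4 0 (Wr x) (Wc x) 0 C) i x"
    unfolding has_pderiv_def
    by (rule derivative_eq_intros refl A[THEN DERIV_cong] B[THEN DERIV_cong] b(3))+
      (simp add: sum_4 dW_def Let_def algebra_simps eval_nat_numeral power_divide)
  then show ?thesis
    by (subst has_pderiv_cong_open[OF open_chart assms weyl_square_kn])
qed

lemma I5_kn:
  assumes "x \<in> chart"
  shows "I5 (kn_metric a m q \<Lambda>) x = (Q x * (Wr x)^2 + P x * (Wc x)^2) / R x"
proof -
  let ?t = "\<lambda>C. - comp4 0 (Wr x) (Wc x) 0 C"
  have "k_covector (kn_metric a m q \<Lambda>) \<mu> x = (\<Sum>C\<in>UNIV. E C \<mu> x * ?t C)" for \<mu>
    by (simp add: k_covector_def pderiv_coord_eqI[OF deriv_weyl_square[OF assms]] sum_negf)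
  then have "I5 (kn_metric a m q \<Lambda>) x = (\<Sum>C\<in>UNIV. ?t C * ?t C / h C x)"
    by (simp only: I5_def contract_index[OF assms])
  also have "\<dots> = (Q x * (Wr x)^2 + P x * (Wc x)^2) / R x"
    using nonzero[OF assms]
    by (simp add: sum_4 h_def kn_point.hh_def field_simps power2_eq_square)
  finally show ?thesis .
qed

text \<open>The closed form divides by \<open>R\<close> alone, so it is continuous even where the
  frame degenerates.\<close>

lemma I5_limit:
  assumes "R p \<noteq> 0"
  shows "(I5 (kn_metric a m q \<Lambda>) \<longlongrightarrow> (Q p * (Wr p)^2 + P p * (Wc p)^2) / R p) (at p within chart)"
proof -
  have "isCont (\<lambda>x. (Q x * (Wr x)^2 + P x * (Wc x)^2) / R x) p"
    using assms unfolding dW_def Let_def Q_def P_def R_def reZ_def imZ_def reZ_r_def reZ_c_def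
        imZ_r_def imZ_c_def
    by (intro continuous_intros) auto
  then have "((\<lambda>x. (Q x * (Wr x)^2 + P x * (Wc x)^2) / R x) \<longlongrightarrow>
      (Q p * (Wr p)^2 + P p * (Wc p)^2) / R p) (at p within chart)"
    using continuous_at_imp_continuous_at_within continuous_within by blast
  then show ?thesis
    by (rule Lim_transform_eventually) (auto simp: eventually_at_filter I5_kn)
qed

end

theorem corollary22:
  fixes a m q \<Lambda> r :: real and p :: "real^4"
  assumes "kn_Xi a \<Lambda> \<noteq> 0"
    and "p $ 2 = r" and "p $ 3 = 0"
    and "a^2 + r^2 \<noteq> 0"
  shows "(I5 (kn_metric a m q \<Lambda>) \<longlongrightarrow>
      - (3072 * (\<Lambda> * a^2 * r^2 + \<Lambda> * r^4 - 3 * a^2 + 6 * m * r - 3 * q^2 - 3 * r^2)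
          / (a^2 + r^2)^15)
      * (21 * a^6 * m^2 * r - 5 * a^6 * m * q^2 - 105 * a^4 * m^2 * r^3
         + 85 * a^4 * m * q^2 * r^2 - 12 * a^4 * q^4 * r
         + 63 * a^2 * m^2 * r^5 - 95 * a^2 * m * q^2 * r^4 + 32 * a^2 * q^4 * r^3
         - 3 * r^7 * m^2 + 7 * m * q^2 * r^6 - 4 * q^4 * r^5)^2)
    (at p within kn_domain a m q \<Lambda>)"
proof -
  interpret kn_spacetime a m q \<Lambda> by unfold_locales fact
  define N where "N = 21 * a^6 * m^2 * r - 5 * a^6 * m * q^2 - 105 * a^4 * m^2 * r^3
         + 85 * a^4 * m * q^2 * r^2 - 12 * a^4 * q^4 * r
         + 63 * a^2 * m^2 * r^5 - 95 * a^2 * m * q^2 * r^4 + 32 * a^2 * q^4 * r^3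
         - 3 * r^7 * m^2 + 7 * m * q^2 * r^6 - 4 * q^4 * r^5"
  define D where "D = \<Lambda> * a^2 * r^2 + \<Lambda> * r^4 - 3 * a^2 + 6 * m * r - 3 * q^2 - 3 * r^2"
  define Y where "Y = a^2 + r^2"
  have Y: "Y \<noteq> 0" using assms(4) by (simp add: Y_def)
  have R: "R p = Y" and Q: "Q p = - D / 3" and P: "P p = 0"
    using assms by (simp_all add: R_def Q_def P_def D_def Y_def field_simps)
  have "(reZ r 1 * reZ_r r 1 - imZ r 1 * imZ_r r 1) * Y - 6 * r * ((reZ r 1)^2 - (imZ r 1)^2) = N"
    unfolding reZ_def imZ_def reZ_r_def imZ_r_def N_def Y_def power_one mult_1_right by algebra
  moreover have "Wr p = 96 * ((reZ r 1 * reZ_r r 1 - imZ r 1 * imZ_r r 1) * Y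
      - 6 * r * ((reZ r 1)^2 - (imZ r 1)^2)) / Y^7"
    using assms Y by (simp add: dW_def R field_simps eval_nat_numeral)
  ultimately have W: "Wr p = 96 * N / Y^7"
    by simp
  have "(Q p * (Wr p)^2 + P p * (Wc p)^2) / R p = - (3072 * D / Y^15) * N^2"
    unfolding R Q P W using Y by (simp add: power_divide power_mult_distrib field_simps
        eval_nat_numeral)
  then show ?thesis
    using I5_limit[of p] Y unfolding R N_def D_def Y_def by simp
qed

end
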